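(* Let $(K,\mathcal{O})$ be a valued field of positive characteristic whose theory is NIP. Then $(K,\mathcal{O})$ is henselian.
   Context: $(K,\mathcal{O})$ is regarded as a structure in the language of rings expanded by a unary predicate for the valuation ring $\mathcal{O}$; NIP refers to its complete theory. *)

theory Defs
  imports "HOL-Computational_Algebra.Polynomial"
begin

section \<open>Valued fields\<close>

text \<open>
  A valued field is a field (here a type of class \<open>field\<close>) together with a valuation ring;
  the trivial valuation \<open>A = UNIV\<close> is allowed. The residue field is \<open>A\<close> modulo its set of
  non-units.
\<close>

definition valuation_ring :: "'a::field set \<Rightarrow> bool" where
  "valuation_ring A \<longleftrightarrow>
     0 \<in> A \<and> 1 \<in> A \<and> (\<forall>x\<in>A. \<forall>y\<in>A. x + y \<in> A \<and> x * y \<in> A) \<and> (\<forall>x\<in>A. - x \<in> A) \<and>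
     (\<forall>x. x \<noteq> 0 \<longrightarrow> x \<in> A \<or> inverse x \<in> A)"

definition maximal_ideal :: "'a::field set \<Rightarrow> 'a set" where
  "maximal_ideal A = {x \<in> A. \<not> (\<exists>y\<in>A. x * y = 1)}"

text \<open>
  Hensel's lemma: if the reduction of a polynomial \<open>f\<close> over \<open>A\<close> has a simple root in the residue
  field, then this root lifts to a root of \<open>f\<close> in \<open>A\<close>.
\<close>

definition henselian :: "'a::field set \<Rightarrow> bool" where
  "henselian A \<longleftrightarrow>
     (\<forall>(f :: 'a poly) a.
        (\<forall>i. coeff f i \<in> A) \<and> a \<in> A \<and>
        poly f a \<in> maximal_ideal A \<and> poly (pderiv f) a \<notin> maximal_ideal A \<longrightarrow>
        (\<exists>b\<in>A. poly f b = 0 \<and> b - a \<in> maximal_ideal A))"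


section \<open>First-order logic in the language of rings with a unary predicate\<close>

datatype ring_term =
    Var nat
  | Zero
  | One
  | Neg ring_term
  | Add ring_term ring_term
  | Mul ring_term ring_term

datatype vfm =
    FEq ring_term ring_term
  | InO ring_term
  | FNot vfm
  | FAnd vfm vfm
  | FEx nat vfm

primrec term_vars :: "ring_term \<Rightarrow> nat set" where
  "term_vars (Var v) = {v}"
| "term_vars Zero = {}"
| "term_vars One = {}"
| "term_vars (Neg s) = term_vars s"
| "term_vars (Add s t) = term_vars s \<union> term_vars t"
| "term_vars (Mul s t) = term_vars s \<union> term_vars t"

primrec free_vars :: "vfm \<Rightarrow> nat set" where
  "free_vars (FEq s t) = term_vars s \<union> term_vars t"
| "free_vars (InO s) = term_vars s"
| "free_vars (FNot p) = free_vars p"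
| "free_vars (FAnd p q) = free_vars p \<union> free_vars q"
| "free_vars (FEx v p) = free_vars p - {v}"

text \<open>The universe of a structure is an arbitrary nonempty set, not necessarily the whole type.\<close>

record 'm struct =
  univ_of :: "'m set"
  zero_of :: 'm
  one_of :: 'm
  neg_of :: "'m \<Rightarrow> 'm"
  add_of :: "'m \<Rightarrow> 'm \<Rightarrow> 'm"
  mul_of :: "'m \<Rightarrow> 'm \<Rightarrow> 'm"
  pred_of :: "'m set"

definition is_struct :: "'m struct \<Rightarrow> bool" where
  "is_struct M \<longleftrightarrow>
     univ_of M \<noteq> {} \<and> zero_of M \<in> univ_of M \<and> one_of M \<in> univ_of M \<and>
     (\<forall>x\<in>univ_of M. neg_of M x \<in> univ_of M) \<and>
     (\<forall>x\<in>univ_of M. \<forall>y\<in>univ_of M. add_of M x y \<in> univ_of M \<and> mul_of M x y \<in> univ_of M) \<and>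
     pred_of M \<subseteq> univ_of M"

primrec eval_term :: "'m struct \<Rightarrow> (nat \<Rightarrow> 'm) \<Rightarrow> ring_term \<Rightarrow> 'm" where
  "eval_term M e (Var v) = e v"
| "eval_term M e Zero = zero_of M"
| "eval_term M e One = one_of M"
| "eval_term M e (Neg s) = neg_of M (eval_term M e s)"
| "eval_term M e (Add s t) = add_of M (eval_term M e s) (eval_term M e t)"
| "eval_term M e (Mul s t) = mul_of M (eval_term M e s) (eval_term M e t)"

primrec sat :: "'m struct \<Rightarrow> (nat \<Rightarrow> 'm) \<Rightarrow> vfm \<Rightarrow> bool" where
  "sat M e (FEq s t) \<longleftrightarrow> eval_term M e s = eval_term M e t"
| "sat M e (InO s) \<longleftrightarrow> eval_term M e s \<in> pred_of M"
| "sat M e (FNot p) \<longleftrightarrow> \<not> sat M e p"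
| "sat M e (FAnd p q) \<longleftrightarrow> sat M e p \<and> sat M e q"
| "sat M e (FEx v p) \<longleftrightarrow> (\<exists>x\<in>univ_of M. sat M (e(v := x)) p)"

definition holds_in :: "'m struct \<Rightarrow> vfm \<Rightarrow> bool" where
  "holds_in M p \<longleftrightarrow> (\<forall>e. range e \<subseteq> univ_of M \<longrightarrow> sat M e p)"

definition complete_theory :: "'m struct \<Rightarrow> vfm set" where
  "complete_theory M = {p. free_vars p = {} \<and> holds_in M p}"

definition is_model :: "'m struct \<Rightarrow> vfm set \<Rightarrow> bool" where
  "is_model M T \<longleftrightarrow> is_struct M \<and> (\<forall>p\<in>T. holds_in M p)"


section \<open>NIP\<close>

text \<open>
  A partitioned formula \<open>p(x;y)\<close> is a formula \<open>p\<close> with a set \<open>X\<close> of variables: the tuple \<open>x\<close>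
  consists of the free variables of \<open>p\<close> in \<open>X\<close>, the tuple \<open>y\<close> of its other free variables. So
  tuples \<open>a\<close> for \<open>x\<close> and \<open>b\<close> for \<open>y\<close> may be given as assignments of all variables, of
  which only the values on the respective free variables of \<open>p\<close> matter.
\<close>

definition sat_partitioned ::
    "'m struct \<Rightarrow> vfm \<Rightarrow> nat set \<Rightarrow> (nat \<Rightarrow> 'm) \<Rightarrow> (nat \<Rightarrow> 'm) \<Rightarrow> bool" where
  "sat_partitioned M p X a b \<longleftrightarrow> sat M (\<lambda>v. if v \<in> X then a v else b v) p"

text \<open>
  The formula has the independence property in \<open>M\<close> if for every \<open>n\<close> there are
  \<open>a\<^sub>0, \<dots>, a\<^sub>n\<^sub>-\<^sub>1\<close> and \<open>b\<^sub>S\<close>, for \<open>S \<subseteq> {0, \<dots>, n - 1}\<close>, in \<open>M\<close> such that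
  \<open>p(a\<^sub>i; b\<^sub>S)\<close> holds in \<open>M\<close> iff \<open>i \<in> S\<close>.
\<close>

definition has_IP :: "'m struct \<Rightarrow> vfm \<Rightarrow> nat set \<Rightarrow> bool" where
  "has_IP M p X \<longleftrightarrow>
     (\<forall>n. \<exists>(a :: nat \<Rightarrow> nat \<Rightarrow> 'm) (b :: nat set \<Rightarrow> nat \<Rightarrow> 'm).
        (\<forall>i. range (a i) \<subseteq> univ_of M) \<and> (\<forall>S. range (b S) \<subseteq> univ_of M) \<and>
        (\<forall>i<n. \<forall>S\<subseteq>{..<n}. sat_partitioned M p X (a i) (b S) \<longleftrightarrow> i \<in> S))"

text \<open>
  A theory is NIP if no partitioned formula has the independence property in a model of it. HOL
  cannot quantify over the models in all types, so the type \<open>'m\<close> containing the universes is a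
  parameter. For a complete theory with a model in \<open>'m\<close> the choice is immaterial: for each
  \<open>n\<close>, the existence of the \<open>a\<^sub>i\<close> and \<open>b\<^sub>S\<close> is expressed by a first-order sentence, which
  holds in all models of the theory or in none.
\<close>

definition NIP_theory :: "'m itself \<Rightarrow> vfm set \<Rightarrow> bool" where
  "NIP_theory _ T \<longleftrightarrow> (\<forall>(M :: 'm struct) p X. is_model M T \<longrightarrow> \<not> has_IP M p X)"

definition valued_field_struct :: "'a::field set \<Rightarrow> 'a struct" where
  "valued_field_struct A =
     \<lparr>univ_of = UNIV, zero_of = 0, one_of = 1, neg_of = uminus, add_of = (+), mul_of = (*),
      pred_of = A\<rparr>"

lemma is_model_complete_theory: "is_struct M \<Longrightarrow> is_model M (complete_theory M)"
  by (simp add: is_model_def complete_theory_def)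

lemma is_struct_valued_field_struct: "is_struct (valued_field_struct A)"
  by (simp add: is_struct_def valued_field_struct_def)

end

(*
  By the Baldwin-Saxl chain condition, NIP makes one member redundant in every sufficiently long
  intersection of subgroups of the form b^-1 T(I^n), where I is a definable submodule and T = Phi - 1
  for a Frobenius-semilinear map Phi. If the valuation ring of scalars has infinite residue field, the
  factors b can be chosen from a Moore matrix so that this redundancy forces T to be surjective on
  I^n (an explicit, valued version of the argument of Kaplan, Scanlon and Wagner).

  Over K itself this shows that K is Artin-Schreier closed, so the residue field of O is infinite.
  Over O, with I the maximal ideal m and Phi the Frobenius of O[z]/(g) for a monic g, it shows that
  x^p - x is surjective on m O[z]/(g), so idempotents lift from the reduction of O[z]/(g); this is
  Hensel's lemma.
*)
theory Submission
  imports Defs "HOL-Library.FuncSet" "HOL-Library.Nat_Bijection"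
begin

section \<open>Valuation rings\<close>

text \<open>The obstacle is integrality: to reach all of I^n by vectors of I^n, and not merely by
  vectors of K^n, every division must be by a unit of the ring of scalars. Hence independence over
  F_p is demanded of residues rather than of elements. It makes the Moore matrices invertible over
  the ring, so that a Moore system with right sides in a submodule has its solution there. NIP
  supplies the length of the intersection without control over it, so arbitrarily many independent
  residues must be available; this is what an infinite residue field provides. The ring of scalars
  is kept apart from the predicate of the structure: the same lemmas are applied with scalars K,
  whose residue field is K itself, and with scalars O, while NIP always concerns the one structure.
  The correction of an idempotent is sought over m so that the lift keeps its reduction. Only g =
  z^(k+1) - z^k + r with r over m has to be treated, since a reciprocal substitution brings Hensel's
  lemma to this form.\<close>

locale valued_field =
  fixes A :: "'a::field set"
  assumes valuation_ring: "valuation_ring A"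
begin

abbreviation P :: "'a set" where "P \<equiv> maximal_ideal A"

lemma zero_mem [simp]: "0 \<in> A"
  and one_mem [simp]: "1 \<in> A"
  and add_mem [intro]: "x \<in> A \<Longrightarrow> y \<in> A \<Longrightarrow> x + y \<in> A"
  and mult_mem [intro]: "x \<in> A \<Longrightarrow> y \<in> A \<Longrightarrow> x * y \<in> A"
  and uminus_mem [intro]: "x \<in> A \<Longrightarrow> - x \<in> A"
  using valuation_ring by (auto simp: valuation_ring_def)

lemma mem_or_inverse_mem: "x \<in> A \<or> inverse x \<in> A"
  using valuation_ring by (cases "x = 0") (auto simp: valuation_ring_def)

lemma diff_mem [intro]: "x \<in> A \<Longrightarrow> y \<in> A \<Longrightarrow> x - y \<in> A"
  using add_mem[of x "- y"] by auto

lemma power_mem [intro]: "x \<in> A \<Longrightarrow> x ^ n \<in> A"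
  by (induction n) auto

lemma sum_mem [intro]: "(\<And>i. i \<in> S \<Longrightarrow> f i \<in> A) \<Longrightarrow> sum f S \<in> A"
  by (induction S rule: infinite_finite_induct) auto

lemma of_nat_mem [simp]: "of_nat n \<in> A"
  by (induction n) auto

lemma max_imp_mem: "x \<in> P \<Longrightarrow> x \<in> A"
  by (simp add: maximal_ideal_def)

lemma nonmax_iff: "x \<in> A \<Longrightarrow> x \<notin> P \<longleftrightarrow> x \<noteq> 0 \<and> inverse x \<in> A"
  unfolding maximal_ideal_def
  by (auto simp: inverse_unique[symmetric] dest: inverse_unique)
    (metis right_inverse)

lemma zero_max [simp]: "0 \<in> P" and one_nonmax [simp]: "1 \<notin> P"
  by (auto simp: maximal_ideal_def)

lemma max_mult:
  assumes "x \<in> A" "y \<in> P" shows "x * y \<in> P"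
proof -
  have "x * y * z \<noteq> 1" if "z \<in> A" for z
  proof
    assume "x * y * z = 1"
    then have "y * (x * z) = 1" by (simp add: mult_ac)
    then show False using assms that mult_mem[of x z] unfolding maximal_ideal_def by blast
  qed
  then show ?thesis using assms by (auto simp: maximal_ideal_def)
qed

lemma max_mult': "x \<in> P \<Longrightarrow> y \<in> A \<Longrightarrow> x * y \<in> P"
  using max_mult[of y x] by (simp add: mult.commute)

lemma inverse_max:
  assumes "x \<notin> A" shows "inverse x \<in> P"
  using assms mem_or_inverse_mem[of x] nonmax_iff[of "inverse x"] by auto

lemma max_add:
  assumes "x \<in> P" "y \<in> P" shows "x + y \<in> P"
proof -
  have *: "x + y \<in> P" if "x \<in> P" "y \<in> P" "y \<noteq> 0" "x / y \<in> A" for x y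
  proof -
    have "x + y = (x / y + 1) * y" using that by (simp add: field_simps)
    then show ?thesis using that by (simp only:) (intro max_mult add_mem, auto)
  qed
  show ?thesis
  proof (cases "x = 0 \<or> y = 0")
    case False
    then have "x / y \<in> A \<or> y / x \<in> A"
      using mem_or_inverse_mem[of "x / y"] by (simp add: field_simps)
    then show ?thesis using *[of x y] *[of y x] assms False by (auto simp: add.commute)
  qed (use assms in auto)
qed

lemma max_uminus: "x \<in> P \<Longrightarrow> - x \<in> P"
  using max_mult[of "-1" x] uminus_mem[of 1] by auto

lemma max_diff: "x \<in> P \<Longrightarrow> y \<in> P \<Longrightarrow> x - y \<in> P"
  using max_add[of x "- y"] max_uminus by auto

lemma nonmax_mult: "x \<in> A \<Longrightarrow> y \<in> A \<Longrightarrow> x \<notin> P \<Longrightarrow> y \<notin> P \<Longrightarrow> x * y \<notin> P"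
  using nonmax_iff[of x] nonmax_iff[of y] nonmax_iff[of "x * y"] by auto

lemma nonmax_power: "x \<in> A \<Longrightarrow> x \<notin> P \<Longrightarrow> x ^ n \<notin> P"
  by (induction n) (use nonmax_mult power_mem in auto)

lemma max_power: "x \<in> P \<Longrightarrow> n > 0 \<Longrightarrow> x ^ n \<in> P"
  by (cases n) (auto intro: max_mult' power_mem max_imp_mem)

lemma nonmax_inverse: "x \<in> A \<Longrightarrow> x \<notin> P \<Longrightarrow> inverse x \<in> A \<and> inverse x \<notin> P"
  using nonmax_iff[of x] nonmax_iff[of "inverse x"] by auto

lemma prod_in_maxD:
  assumes "finite S" "\<And>i. i \<in> S \<Longrightarrow> f i \<in> A" "prod f S \<in> P"
  shows "\<exists>i\<in>S. f i \<in> P"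
proof (rule ccontr)
  assume *: "\<not> ?thesis"
  have "prod f S \<in> A \<and> prod f S \<notin> P"
    using assms(1,2) * by (induction S rule: finite_induct) (auto simp: nonmax_mult)
  with assms show False by blast
qed

text \<open>Moore systems are studied with values in an arbitrary submodule \<open>W\<close> of K.
  The choice \<open>W = A\<close> gives integrality, \<open>P\<close> gives nonvanishing of
  residues, \<open>{0}\<close> gives uniqueness, and \<open>I\<close> keeps solutions inside the
  definable module.\<close>

definition submodule :: "'a set \<Rightarrow> bool" where
  "submodule W \<longleftrightarrow> 0 \<in> W \<and> (\<forall>x\<in>W. \<forall>y\<in>W. x + y \<in> W) \<and> (\<forall>a\<in>A. \<forall>x\<in>W. a * x \<in> W)"

lemma submodule_zero [simp]: "submodule W \<Longrightarrow> 0 \<in> W"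
  and submodule_add: "submodule W \<Longrightarrow> x \<in> W \<Longrightarrow> y \<in> W \<Longrightarrow> x + y \<in> W"
  and submodule_scale: "submodule W \<Longrightarrow> a \<in> A \<Longrightarrow> x \<in> W \<Longrightarrow> a * x \<in> W"
  by (auto simp: submodule_def)

lemma submodule_diff: "submodule W \<Longrightarrow> x \<in> W \<Longrightarrow> y \<in> W \<Longrightarrow> x - y \<in> W"
  using submodule_add[of W x "-1 * y"] submodule_scale[of W "-1" y] uminus_mem[of 1] by auto

lemma submodule_sum:
  "submodule W \<Longrightarrow> (\<And>i. i \<in> S \<Longrightarrow> f i \<in> W) \<Longrightarrow> sum f S \<in> W"
  by (induction S rule: infinite_finite_induct) (auto simp: submodule_add)

lemma submodule_ring: "submodule A"
  and submodule_max: "submodule P"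
  and submodule_singleton_zero: "submodule {0}"
  by (auto simp: submodule_def max_add max_mult)

end

section \<open>Frobenius and the prime field in characteristic p\<close>

locale char_p_valued_field = valued_field A for A :: "'a::field set" +
  fixes p :: nat
  assumes p_char: "p = CHAR('a)" and p_pos: "p > 0"
begin

lemma prime_p: "prime p"
  using prime_CHAR_semidom p_char p_pos by metis

lemma p_gt_1: "p > 1"
  using prime_p prime_gt_1_nat by blast

lemma frob_add: "(x + y :: 'a) ^ p = x ^ p + y ^ p"
  using freshmans_dream[where ?'a = 'a and n = p and x = x and y = y] prime_p p_char by simp

lemma frob_sum: "(sum f S :: 'a) ^ p = (\<Sum>i\<in>S. f i ^ p)"
  using freshmans_dream_sum[where ?'a = 'a and n = p and f = f and A = S] prime_p p_char by simp

lemma frob_uminus: "(- x :: 'a) ^ p = - (x ^ p)"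
  using minus_power_prime_CHAR[where ?'a = 'a and p = p and x = x] prime_p p_char by simp

lemma frob_diff: "(x - y :: 'a) ^ p = x ^ p - y ^ p"
  using frob_add[of x "- y"] frob_uminus[of y] by simp

definition Fp :: "'a set" where "Fp = {c. c ^ p = c}"

lemma Fp_frob: "c \<in> Fp \<Longrightarrow> c ^ p = c"
  by (simp add: Fp_def)

lemma Fp_0 [simp]: "0 \<in> Fp" and Fp_1 [simp]: "1 \<in> Fp"
  using p_pos by (auto simp: Fp_def)

lemma Fp_add: "x \<in> Fp \<Longrightarrow> y \<in> Fp \<Longrightarrow> x + y \<in> Fp"
  and Fp_mult: "x \<in> Fp \<Longrightarrow> y \<in> Fp \<Longrightarrow> x * y \<in> Fp"
  and Fp_uminus: "x \<in> Fp \<Longrightarrow> - x \<in> Fp"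
  and Fp_inverse: "x \<in> Fp \<Longrightarrow> inverse x \<in> Fp"
  by (auto simp: Fp_def frob_add frob_uminus power_mult_distrib power_inverse)

lemma Fp_of_nat [simp]: "of_nat n \<in> Fp"
  by (induction n) (auto intro: Fp_add)

lemma artin_schreier_product: "(x :: 'a) ^ p - x = (\<Prod>i<p. x - of_nat i)"
proof -
  let ?f = "monom (1::'a) p - monom 1 1" and ?g = "\<Prod>i<p. [:- of_nat i, 1 :: 'a:]"
  have lc: "lead_coeff ?g = 1" by (simp add: lead_coeff_prod)
  have deg: "degree ?g = p" by (subst degree_prod_eq_sum_degree) auto
  have "?f = ?g"
  proof (rule poly_eqI_degree_lead_coeff[where A = "of_nat ` {..<p}" and n = p])
    have "inj_on (of_nat :: nat \<Rightarrow> 'a) {..<p}"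
    proof (rule inj_onI)
      fix i j assume "i \<in> {..<p}" "j \<in> {..<p}" and eq: "of_nat i = (of_nat j :: 'a)"
      then show "i = j"
      proof (induction i j rule: linorder_wlog)
        case (le a b)
        then have "of_nat (b - a) = (0::'a)" by (simp add: of_nat_diff)
        then have "p dvd b - a" by (simp add: of_nat_eq_0_iff_char_dvd p_char)
        with le show ?case by (auto dest!: dvd_imp_le)
      qed auto
    qed
    then show "card ((of_nat :: nat \<Rightarrow> 'a) ` {..<p}) \<ge> p" by (simp add: card_image)
    show "degree ?f \<le> p"
      using p_gt_1 by (intro degree_diff_le) (auto simp: degree_monom_eq)
    show "coeff ?f p = coeff ?g p" using p_gt_1 lc deg by simp
    fix z assume "z \<in> (of_nat :: nat \<Rightarrow> 'a) ` {..<p}"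
    then show "poly ?f z = poly ?g z"
      using Fp_of_nat by (auto simp: poly_monom poly_prod Fp_def)
  qed (use deg in auto)
  then have "poly ?f x = poly ?g x" by simp
  then show ?thesis by (simp add: poly_monom poly_prod)
qed

lemma Fp_eq: "Fp = of_nat ` {..<p}"
proof (intro set_eqI iffI)
  fix c assume "c \<in> Fp"
  then have "(\<Prod>i<p. c - of_nat i) = 0" using artin_schreier_product[of c] by (simp add: Fp_def)
  then show "c \<in> of_nat ` {..<p}" by auto
qed auto

lemma finite_Fp: "finite Fp" by (simp add: Fp_eq)

lemma Fp_mem: "c \<in> Fp \<Longrightarrow> c \<in> A" by (auto simp: Fp_eq)

lemma Fp_nonmax: "c \<in> Fp \<Longrightarrow> c \<noteq> 0 \<Longrightarrow> c \<notin> P"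
  using Fp_inverse Fp_mem nonmax_iff by blast

text \<open>\<open>P\<close> is prime, so one of the factors in
  \<open>artin_schreier_product\<close> lies in it. In other words, the residue field has no roots
  of \<open>x ^ p - x\<close> beyond the prime field.\<close>

lemma artin_schreier_max:
  assumes "x \<in> A" "x ^ p - x \<in> P"
  shows "\<exists>c\<in>Fp. x - c \<in> P"
proof -
  have "\<exists>i\<in>{..<p}. x - of_nat i \<in> P"
    by (rule prod_in_maxD) (use assms artin_schreier_product[of x] in auto)
  then show ?thesis using Fp_of_nat by blast
qed

section \<open>Moore systems\<close>

text \<open>Linear independence of the residues over the prime field. It makes the Moore matrix with
  entries \<open>\<mu> j ^ (p ^ i)\<close>, \<open>i < card S\<close>, invertible over
  \<open>A\<close>; independence of the elements themselves would give this over K only.\<close>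

definition residually_indep :: "'i set \<Rightarrow> ('i \<Rightarrow> 'a) \<Rightarrow> bool" where
  "residually_indep S \<mu> \<longleftrightarrow> (\<forall>j\<in>S. \<mu> j \<in> A) \<and>
     (\<forall>c. (\<forall>j\<in>S. c j \<in> Fp) \<and> (\<exists>j\<in>S. c j \<noteq> 0) \<longrightarrow> (\<Sum>j\<in>S. c j * \<mu> j) \<notin> P)"

lemma residually_indep_mem: "residually_indep S \<mu> \<Longrightarrow> j \<in> S \<Longrightarrow> \<mu> j \<in> A"
  by (simp add: residually_indep_def)

lemma residually_indepD:
  "residually_indep S \<mu> \<Longrightarrow> (\<And>j. j \<in> S \<Longrightarrow> c j \<in> Fp) \<Longrightarrow> j \<in> S \<Longrightarrow> c j \<noteq> 0 \<Longrightarrow>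
     (\<Sum>j\<in>S. c j * \<mu> j) \<notin> P"
  unfolding residually_indep_def by blast

lemma residually_indep_nonmax:
  assumes "finite S" "residually_indep S \<mu>" "j \<in> S"
  shows "\<mu> j \<notin> P"
proof -
  have "(\<Sum>i\<in>S. (if i = j then 1 else 0) * \<mu> i) = \<mu> j"
    using assms by (simp add: if_distrib[of "\<lambda>x. x * _"] cong: if_cong)
  then show ?thesis
    using residually_indepD[OF assms(2) _ assms(3), of "\<lambda>i. if i = j then 1 else 0"] by simp
qed

lemma residually_indep_subset:
  assumes "finite S" "residually_indep S \<mu>" "T \<subseteq> S"
  shows "residually_indep T \<mu>"
  unfolding residually_indep_def
proof (intro conjI allI impI ballI)
  fix c assume c: "(\<forall>j\<in>T. c j \<in> Fp) \<and> (\<exists>j\<in>T. c j \<noteq> 0)"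
  then obtain j where j: "j \<in> T" "c j \<noteq> 0" by blast
  then have "j \<in> S" using assms(3) by blast
  have "(\<Sum>i\<in>S. (if i \<in> T then c i else 0) * \<mu> i) = (\<Sum>i\<in>T. c i * \<mu> i)"
    using assms by (intro sum.mono_neutral_cong_right) auto
  then show "(\<Sum>i\<in>T. c i * \<mu> i) \<notin> P"
    using residually_indepD[OF assms(2), of "\<lambda>i. if i \<in> T then c i else 0" j] c j \<open>j \<in> S\<close> by simp
qed (use assms in \<open>auto simp: residually_indep_def\<close>)

lemma residually_indep_frob:
  assumes "residually_indep S \<mu>"
  shows "residually_indep S (\<lambda>j. \<mu> j ^ p)"
  unfolding residually_indep_def
proof (intro conjI allI impI ballI)
  fix c assume c: "(\<forall>j\<in>S. c j \<in> Fp) \<and> (\<exists>j\<in>S. c j \<noteq> 0)"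
  have "(\<Sum>j\<in>S. c j * \<mu> j ^ p) = (\<Sum>j\<in>S. c j * \<mu> j) ^ p"
    using c by (auto simp: frob_sum power_mult_distrib Fp_frob intro!: sum.cong)
  moreover have "(\<Sum>j\<in>S. c j * \<mu> j) \<notin> P"
    using c residually_indepD[OF assms, of c] by blast
  moreover have "(\<Sum>j\<in>S. c j * \<mu> j) \<in> A"
    using c residually_indep_mem[OF assms] Fp_mem by blast
  ultimately show "(\<Sum>j\<in>S. c j * \<mu> j ^ p) \<notin> P"
    using nonmax_power by simp
qed (use residually_indep_mem[OF assms] in auto)

text \<open>
  The additive polynomial \<open>x\<^sup>p - y\<^sup>p\<^sup>-\<^sup>1 x\<close> has kernel \<open>\<F>\<^sub>p y\<close>; substituting the members of
  a family into it, with \<open>y\<close> one of them, eliminates \<open>y\<close>.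
\<close>
definition elim :: "('i \<Rightarrow> 'a) \<Rightarrow> 'i \<Rightarrow> 'i \<Rightarrow> 'a" where
  "elim \<mu> m j = \<mu> j ^ p - \<mu> m ^ (p - 1) * \<mu> j"

lemma power_p_eq: "(x :: 'a) ^ p = x ^ (p - 1) * x"
  using p_pos by (cases p) auto

lemma elim_self: "elim \<mu> m m = 0"
  by (simp add: elim_def power_p_eq[of "\<mu> m"])

text \<open>A combination of the new family is \<open>s ^ p - \<mu> m ^ (p - 1) * s\<close>, where
  \<open>s\<close> is the same combination of the old one. Up to the unit \<open>\<mu> m ^ p\<close>
  this is the Artin-Schreier expression of \<open>s / \<mu> m\<close>. If it lies in
  \<open>P\<close>, then \<open>s\<close> is congruent to an F_p-multiple of \<open>\<mu> m\<close>,
  a forbidden relation.\<close>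

lemma residually_indep_elim:
  assumes S: "finite S" and indep: "residually_indep S \<mu>" and m: "m \<in> S"
  shows "residually_indep (S - {m}) (elim \<mu> m)"
  unfolding residually_indep_def
proof (intro conjI allI impI ballI)
  fix c assume c: "(\<forall>j\<in>S-{m}. c j \<in> Fp) \<and> (\<exists>j\<in>S-{m}. c j \<noteq> 0)"
  define s where "s = (\<Sum>j\<in>S-{m}. c j * \<mu> j)"
  have sA: "s \<in> A"
    using c residually_indep_mem[OF indep] Fp_mem unfolding s_def by blast
  have mA: "\<mu> m \<in> A" "\<mu> m \<notin> P" "\<mu> m \<noteq> 0" "inverse (\<mu> m) \<in> A"
    using residually_indep_mem[OF indep m] residually_indep_nonmax[OF S indep m]
      nonmax_iff[of "\<mu> m"] by auto
  have eq: "(\<Sum>j\<in>S-{m}. c j * elim \<mu> m j) = s ^ p - \<mu> m ^ (p - 1) * s"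
    unfolding s_def frob_sum elim_def right_diff_distrib sum_subtractf sum_distrib_left
    using c by (intro arg_cong2[of _ _ _ _ "(-)"] sum.cong)
      (auto simp: power_mult_distrib Fp_frob)
  show "(\<Sum>j\<in>S-{m}. c j * elim \<mu> m j) \<notin> P"
  proof
    assume "(\<Sum>j\<in>S-{m}. c j * elim \<mu> m j) \<in> P"
    then have *: "inverse (\<mu> m) ^ p * (s ^ p - \<mu> m ^ (p - 1) * s) \<in> P"
      using mA unfolding eq by (intro max_mult power_mem)
    have "inverse (\<mu> m) ^ p * (s ^ p - \<mu> m ^ (p - 1) * s) = (s / \<mu> m) ^ p - s / \<mu> m"
      using mA power_p_eq[of "\<mu> m"] by (simp add: field_simps)
    with * have "(s / \<mu> m) ^ p - s / \<mu> m \<in> P" by simp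
    moreover have "s / \<mu> m \<in> A" using sA mA by (simp add: divide_inverse mult_mem)
    ultimately obtain d where d: "d \<in> Fp" "s / \<mu> m - d \<in> P"
      using artin_schreier_max by blast
    have "s - d * \<mu> m = \<mu> m * (s / \<mu> m - d)" using mA by (simp add: field_simps)
    then have sP: "s - d * \<mu> m \<in> P" using d mA by (simp add: max_mult)
    define c' where "c' = c(m := - d)"
    have "(\<Sum>j\<in>S. c' j * \<mu> j) = c' m * \<mu> m + (\<Sum>j\<in>S-{m}. c' j * \<mu> j)"
      using S m by (rule sum.remove)
    also have "(\<Sum>j\<in>S-{m}. c' j * \<mu> j) = s"
      unfolding s_def by (intro sum.cong) (auto simp: c'_def)
    finally have "(\<Sum>j\<in>S. c' j * \<mu> j) = s - d * \<mu> m" by (simp add: c'_def)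
    moreover have "(\<Sum>j\<in>S. c' j * \<mu> j) \<notin> P"
    proof -
      obtain j where "j \<in> S - {m}" "c j \<noteq> 0" using c by blast
      then show ?thesis
        using c d by (intro residually_indepD[OF indep, of _ j]) (auto simp: c'_def Fp_uminus)
    qed
    ultimately show False using sP by simp
  qed
next
  fix j assume "j \<in> S - {m}"
  then show "elim \<mu> m j \<in> A"
    using residually_indep_mem[OF indep] m unfolding elim_def by auto
qed

text \<open>Gaussian elimination on the rows: row \<open>Suc i\<close> minus a multiple of row
  \<open>i\<close> removes the unknown at \<open>m\<close>, and what remains is again a Moore
  system, for the family \<open>elim \<mu> m\<close>.\<close>

lemma moore_elim:
  assumes "finite S" "m \<in> S"
  shows "(\<Sum>j\<in>S-{m}. elim \<mu> m j ^ (p ^ i) * x j) =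
    (\<Sum>j\<in>S. \<mu> j ^ (p ^ Suc i) * x j) - \<mu> m ^ ((p - 1) * p ^ i) * (\<Sum>j\<in>S. \<mu> j ^ (p ^ i) * x j)"
proof -
  have "elim \<mu> m j ^ (p ^ i) = \<mu> j ^ (p ^ Suc i) - \<mu> m ^ ((p - 1) * p ^ i) * \<mu> j ^ (p ^ i)" for j
  proof (induction i)
    case (Suc i)
    have "elim \<mu> m j ^ (p ^ Suc i) = (elim \<mu> m j ^ (p ^ i)) ^ p"
      by (simp add: power_mult[symmetric] mult.commute)
    also have "\<dots> = \<mu> j ^ (p ^ Suc (Suc i)) - \<mu> m ^ ((p - 1) * p ^ Suc i) * \<mu> j ^ (p ^ Suc i)"
      unfolding Suc frob_diff power_mult_distrib power_mult[symmetric] by (simp add: mult_ac)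
    finally show ?case .
  qed (simp add: elim_def)
  then have "(\<Sum>j\<in>S. elim \<mu> m j ^ (p ^ i) * x j) =
    (\<Sum>j\<in>S. \<mu> j ^ (p ^ Suc i) * x j) - \<mu> m ^ ((p - 1) * p ^ i) * (\<Sum>j\<in>S. \<mu> j ^ (p ^ i) * x j)"
    by (simp add: sum_subtractf left_diff_distrib sum_distrib_left mult.assoc)
  moreover have "(\<Sum>j\<in>S. elim \<mu> m j ^ (p ^ i) * x j) = (\<Sum>j\<in>S-{m}. elim \<mu> m j ^ (p ^ i) * x j)"
    using assms p_pos by (subst sum.remove[OF assms]) (simp add: elim_self)
  ultimately show ?thesis by simp
qed

text \<open>Eliminating \<open>j\<close> puts all other unknowns into \<open>W\<close> by induction.
  The equation with \<open>i = 0\<close> then puts \<open>\<mu> j * x j\<close> there, and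
  \<open>\<mu> j\<close> is a unit.\<close>

lemma moore_submodule:
  assumes "finite S" "residually_indep S \<mu>" "submodule W"
    and "\<And>i. i < card S \<Longrightarrow> (\<Sum>j\<in>S. \<mu> j ^ (p ^ i) * x j) \<in> W"
    and "j \<in> S"
  shows "x j \<in> W"
  using assms(1,2,4,5)
proof (induction "card S" arbitrary: S \<mu> j)
  case (Suc N)
  have rest: "x j \<in> W" if "j \<in> S - {m}" "m \<in> S" for j m
  proof (rule Suc.hyps(1))
    show "N = card (S - {m})" using Suc.hyps(2) Suc.prems(1) that by simp
    show "residually_indep (S - {m}) (elim \<mu> m)"
      using Suc.prems that by (intro residually_indep_elim)
    fix i assume "i < card (S - {m})"
    then have "Suc i < card S" using Suc.hyps(2) Suc.prems(1) that by simp
    then show "(\<Sum>j\<in>S-{m}. elim \<mu> m j ^ (p ^ i) * x j) \<in> W"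
      unfolding moore_elim[OF Suc.prems(1) \<open>m \<in> S\<close>]
      using that Suc.prems(3)[of "Suc i"] Suc.prems(3)[of i] residually_indep_mem[OF Suc.prems(2)] assms(3)
      by (intro submodule_diff submodule_scale power_mem) auto
  qed (use that Suc.prems in auto)
  have "(\<Sum>k\<in>S. \<mu> k ^ (p ^ 0) * x k) \<in> W"
    using Suc.prems Suc.hyps(2) by (intro Suc.prems) auto
  then have "\<mu> j * x j + (\<Sum>k\<in>S-{j}. \<mu> k * x k) \<in> W"
    using sum.remove[OF Suc.prems(1,4), of "\<lambda>k. \<mu> k * x k"] by simp
  moreover have "(\<Sum>k\<in>S-{j}. \<mu> k * x k) \<in> W"
    using assms(3) residually_indep_mem[OF Suc.prems(2)] rest[of _ j] Suc.prems(4)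
    by (intro submodule_sum submodule_scale) auto
  ultimately have "\<mu> j * x j \<in> W"
    using submodule_diff[OF assms(3)] by fastforce
  moreover have "inverse (\<mu> j) \<in> A"
    using nonmax_inverse[OF residually_indep_mem[OF Suc.prems(2,4)]]
      residually_indep_nonmax[OF Suc.prems(1,2,4)] by blast
  ultimately have "inverse (\<mu> j) * (\<mu> j * x j) \<in> W"
    using assms(3) submodule_scale by blast
  moreover have "\<mu> j \<noteq> 0" using residually_indep_nonmax[OF Suc.prems(1,2,4)] by auto
  ultimately show ?case by (simp add: mult.assoc[symmetric])
qed auto

text \<open>The solution is only claimed in K; where it lies is decided afterwards by
  \<open>moore_submodule\<close>. The eliminated system determines the unknowns other than
  \<open>x m\<close>, row 0 then fixes \<open>x m\<close>, and the further rows follow one from the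
  other by \<open>moore_elim\<close>.\<close>

lemma moore_solvable:
  assumes "finite S" "residually_indep S \<mu>"
  shows "\<exists>x. \<forall>i<card S. (\<Sum>j\<in>S. \<mu> j ^ (p ^ i) * x j) = u i"
  using assms
proof (induction "card S" arbitrary: S \<mu> u)
  case (Suc N)
  then obtain m where m: "m \<in> S" by fastforce
  have cardm: "N = card (S - {m})" using Suc.hyps(2) Suc.prems(1) m by simp
  define u' where "u' i = u (Suc i) - \<mu> m ^ ((p - 1) * p ^ i) * u i" for i
  obtain x' where x': "\<And>i. i < N \<Longrightarrow> (\<Sum>j\<in>S-{m}. elim \<mu> m j ^ (p ^ i) * x' j) = u' i"
    using Suc.hyps(1)[OF cardm _ residually_indep_elim[OF Suc.prems m], of u'] Suc.prems(1) cardm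
    by auto
  define x where "x = x'(m := (u 0 - (\<Sum>j\<in>S-{m}. \<mu> j * x' j)) / \<mu> m)"
  have x: "(\<Sum>j\<in>S-{m}. elim \<mu> m j ^ (p ^ i) * x j) = u' i" if "i < N" for i
    using x'[OF that] by (auto simp: x_def intro!: sum.cong)
  have "\<mu> m \<noteq> 0" using residually_indep_nonmax[OF Suc.prems m] by auto
  note elimi = moore_elim[OF Suc.prems(1) m, of \<mu> _ x] and cardS = Suc.hyps(2)
  have "(\<Sum>j\<in>S. \<mu> j ^ (p ^ i) * x j) = u i" if "i < card S" for i
    using that
  proof (induction i)
    case 0
    have "(\<Sum>j\<in>S. \<mu> j * x j) = \<mu> m * x m + (\<Sum>j\<in>S-{m}. \<mu> j * x j)"
      by (rule sum.remove[OF Suc.prems(1) m])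
    also have "(\<Sum>j\<in>S-{m}. \<mu> j * x j) = (\<Sum>j\<in>S-{m}. \<mu> j * x' j)"
      by (intro sum.cong) (auto simp: x_def)
    finally show ?case using \<open>\<mu> m \<noteq> 0\<close> by (simp add: x_def)
  next
    case (Suc i)
    then show ?case
      using x[of i] elimi[of i] cardS by (simp add: u'_def)
  qed
  then show ?case by blast
qed auto

text \<open>The weights span the kernel of the Moore matrix without its row 0. Normalised by
  \<open>b m = 1\<close>, they are integral by \<open>moore_submodule\<close> with
  \<open>W = A\<close>. If some \<open>b k\<close> were in \<open>P\<close>, the system without
  \<open>k\<close> would have right sides in \<open>P\<close> and force \<open>b m\<close> into
  \<open>P\<close>.\<close>

lemma dual_weights:
  assumes S: "finite S" and indep: "residually_indep S \<mu>" and "S \<noteq> {}"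
  obtains b where "\<And>j. j \<in> S \<Longrightarrow> b j \<in> A" "\<And>j. j \<in> S \<Longrightarrow> b j \<notin> P"
    and "\<And>i. 0 < i \<Longrightarrow> i < card S \<Longrightarrow> (\<Sum>j\<in>S. \<mu> j ^ (p ^ i) * b j) = 0"
proof -
  obtain m where m: "m \<in> S" using assms by blast
  \<comment> \<open>Row \<open>Suc i\<close> of the Moore matrix of \<open>\<mu>\<close> is row
    \<open>i\<close> of that of \<open>?\<nu>\<close>.\<close>
  let ?\<nu> = "\<lambda>j. \<mu> j ^ p"
  have ind: "residually_indep (S - {k}) ?\<nu>" for k
    using residually_indep_subset[OF S residually_indep_frob[OF indep]] by blast
  have fin: "finite (S - {k})" for k using S by simp
  obtain x where x: "\<And>i. i < card (S - {m}) \<Longrightarrow>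
      (\<Sum>j\<in>S-{m}. ?\<nu> j ^ (p ^ i) * x j) = - (?\<nu> m ^ (p ^ i))"
    using moore_solvable[OF fin ind, of m "\<lambda>i. - (?\<nu> m ^ (p ^ i))"] by blast
  define b where "b = x(m := 1)"
  have b0: "(\<Sum>j\<in>S. ?\<nu> j ^ (p ^ i) * b j) = 0" if "i < card (S - {m})" for i
  proof -
    have "(\<Sum>j\<in>S. ?\<nu> j ^ (p ^ i) * b j) = ?\<nu> m ^ (p ^ i) * b m + (\<Sum>j\<in>S-{m}. ?\<nu> j ^ (p ^ i) * b j)"
      by (rule sum.remove[OF S m])
    also have "(\<Sum>j\<in>S-{m}. ?\<nu> j ^ (p ^ i) * b j) = (\<Sum>j\<in>S-{m}. ?\<nu> j ^ (p ^ i) * x j)"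
      by (intro sum.cong) (auto simp: b_def)
    finally show ?thesis using x[OF that] by (simp add: b_def)
  qed
  have bA: "b j \<in> A" if "j \<in> S" for j
  proof (cases "j = m")
    case False
    have "x j \<in> A"
    proof (rule moore_submodule[OF fin ind submodule_ring])
      fix i assume "i < card (S - {m})"
      then show "(\<Sum>j\<in>S-{m}. ?\<nu> j ^ (p ^ i) * x j) \<in> A"
        using residually_indep_mem[OF indep m] by (auto simp: x intro!: uminus_mem power_mem)
    qed (use False that in auto)
    then show ?thesis using False by (simp add: b_def)
  qed (simp add: b_def)
  have bP: "b k \<notin> P" if k: "k \<in> S" for k
  proof
    assume kP: "b k \<in> P"
    have "k \<noteq> m" using kP by (auto simp: b_def)
    have "b m \<in> P"
    proof (rule moore_submodule[OF fin ind submodule_max, of k])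
      fix i assume "i < card (S - {k})"
      then have "(\<Sum>j\<in>S. ?\<nu> j ^ (p ^ i) * b j) = 0"
        using S k m by (intro b0) simp
      then have "(\<Sum>j\<in>S-{k}. ?\<nu> j ^ (p ^ i) * b j) = - (?\<nu> k ^ (p ^ i) * b k)"
        using sum.remove[OF S k, of "\<lambda>j. ?\<nu> j ^ (p ^ i) * b j"] by (simp add: eq_neg_iff_add_eq_0 add.commute)
      then show "(\<Sum>j\<in>S-{k}. ?\<nu> j ^ (p ^ i) * b j) \<in> P"
        using kP residually_indep_mem[OF indep k] by (auto intro!: max_uminus max_mult power_mem)
    qed (use m \<open>k \<noteq> m\<close> in auto)
    then show False by (simp add: b_def)
  qed
  show ?thesis
  proof (rule that[OF bA bP])
    fix i :: nat assume "0 < i" "i < card S"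
    then obtain i' where "i = Suc i'" "i' < card (S - {m})" using S m by (cases i) auto
    then show "(\<Sum>j\<in>S. \<mu> j ^ (p ^ i) * b j) = 0"
      using b0[of i'] by (simp add: power_mult)
  qed
qed

definition residue_field_infinite :: bool where
  "residue_field_infinite \<longleftrightarrow> (\<forall>F. finite F \<longrightarrow> (\<exists>x\<in>A. \<forall>f\<in>F. x - f \<notin> P))"

text \<open>The F_p-combinations of a finite family meet only finitely many residue classes, so a
  further member can be chosen outside them.\<close>

lemma residually_indep_exists:
  assumes "residue_field_infinite" "finite S"
  shows "\<exists>\<mu>. residually_indep S \<mu>"
  using assms(2)
proof (induction S rule: finite_induct)
  case empty
  then show ?case by (auto simp: residually_indep_def)
next
  case (insert m S)
  then obtain \<mu> where \<mu>: "residually_indep S \<mu>" by blast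
  define F where "F = (\<lambda>c. \<Sum>j\<in>S. c j * \<mu> j) ` (\<Pi>\<^sub>E j\<in>S. Fp)"
  have "finite F" unfolding F_def using insert.hyps finite_Fp by (intro finite_imageI finite_PiE) auto
  then obtain x where x: "x \<in> A" "\<And>f. f \<in> F \<Longrightarrow> x - f \<notin> P"
    using assms(1)[unfolded residue_field_infinite_def, rule_format, OF \<open>finite F\<close>] by auto
  have "residually_indep (insert m S) (\<mu>(m := x))"
    unfolding residually_indep_def
  proof (intro conjI allI impI ballI)
    fix c assume c: "(\<forall>j\<in>insert m S. c j \<in> Fp) \<and> (\<exists>j\<in>insert m S. c j \<noteq> 0)"
    have eq: "(\<Sum>j\<in>insert m S. c j * (\<mu>(m := x)) j) = c m * x + (\<Sum>j\<in>S. c j * \<mu> j)"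
      using insert.hyps by (auto intro!: sum.cong)
    show "(\<Sum>j\<in>insert m S. c j * (\<mu>(m := x)) j) \<notin> P"
    proof (cases "c m = 0")
      case True
      then show ?thesis using c eq residually_indepD[OF \<mu>, of c] by auto
    next
      case False
      define d where "d = restrict (\<lambda>j. - inverse (c m) * c j) S"
      have "d \<in> (\<Pi>\<^sub>E j\<in>S. Fp)"
        using c by (auto simp: d_def intro!: Fp_uminus Fp_mult Fp_inverse)
      then have "x - (\<Sum>j\<in>S. d j * \<mu> j) \<notin> P" using x(2) by (auto simp: F_def)
      moreover have "(\<Sum>j\<in>S. d j * \<mu> j) = - inverse (c m) * (\<Sum>j\<in>S. c j * \<mu> j)"
        unfolding sum_distrib_left by (intro sum.cong) (auto simp: d_def)
      then have "c m * (x - (\<Sum>j\<in>S. d j * \<mu> j)) = c m * x + (\<Sum>j\<in>S. c j * \<mu> j)"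
        using False by (simp add: field_simps)
      moreover have "c m \<in> A" "c m \<notin> P" using c False Fp_mem Fp_nonmax by auto
      moreover have "x - (\<Sum>j\<in>S. d j * \<mu> j) \<in> A"
        using x(1) \<open>d \<in> _\<close> Fp_mem residually_indep_mem[OF \<mu>] by (intro diff_mem sum_mem mult_mem) auto
      ultimately show ?thesis using nonmax_mult eq by metis
    qed
  qed (use residually_indep_mem[OF \<mu>] x insert.hyps in auto)
  then show ?case by blast
qed

section \<open>Surjectivity of the Artin--Schreier map\<close>

text \<open>The Frobenius-semilinear map that sends the basis vector with index \<open>k\<close> to
  the vector \<open>c k\<close>. Vectors are functions on all naturals, of which the coordinates
  below \<open>n\<close> count.\<close>

definition frob_map :: "nat \<Rightarrow> (nat \<Rightarrow> nat \<Rightarrow> 'a) \<Rightarrow> (nat \<Rightarrow> 'a) \<Rightarrow> nat \<Rightarrow> 'a" where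
  "frob_map n c x i = (\<Sum>k<n. c k i * x k ^ p)"

lemma frob_map_cong: "(\<And>k. k < n \<Longrightarrow> x k = y k) \<Longrightarrow> frob_map n c x i = frob_map n c y i"
  by (simp add: frob_map_def)

lemma frob_map_add: "frob_map n c (\<lambda>k. x k + y k) i = frob_map n c x i + frob_map n c y i"
  by (simp add: frob_map_def frob_add ring_distribs sum.distrib)

lemma frob_map_scale: "frob_map n c (\<lambda>k. a * x k) i = a ^ p * frob_map n c x i"
  by (simp add: frob_map_def power_mult_distrib sum_distrib_left mult_ac)

lemma frob_map_sum: "frob_map n c (\<lambda>k. \<Sum>j\<in>S. d j * x j k) i = (\<Sum>j\<in>S. d j ^ p * frob_map n c (x j) i)"
  unfolding frob_map_def frob_sum power_mult_distrib sum_distrib_left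
  by (subst sum.swap) (simp add: mult_ac)

definition artin_schreier_image :: "nat \<Rightarrow> (nat \<Rightarrow> nat \<Rightarrow> 'a) \<Rightarrow> 'a set \<Rightarrow> (nat \<Rightarrow> 'a) \<Rightarrow> bool" where
  "artin_schreier_image n c I t \<longleftrightarrow> (\<exists>y. (\<forall>i<n. y i \<in> I) \<and> (\<forall>i<n. t i = frob_map n c y i - y i))"

text \<open>
  With \<open>T = \<Phi> - 1\<close> and \<open>\<Phi>\<close> the semilinear map \<open>frob_map n c\<close>: if \<open>T x\<^sub>j = b\<^sub>j t\<close> for all \<open>j \<in> S\<close>,
  then the equations for \<open>b\<close> give \<open>\<Phi>\<^sup>i (\<Sum>\<^sub>j \<mu>\<^sub>j x\<^sub>j) = \<Sum>\<^sub>j \<mu>\<^sub>j\<^sup>p\<^sup>^\<^sup>i x\<^sub>j\<close> for \<open>i < card S\<close>, so a single vector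
  parametrizes the simultaneous solutions. Without the index \<open>m\<close> the same holds for
  \<open>elim \<mu> m\<close>, and the two parameters \<open>w\<close> and \<open>u\<close> are related by
  \<open>u = \<Phi> w - \<mu>\<^sub>m\<^sup>p\<^sup>-\<^sup>1 w\<close>, a rescaling of \<open>T\<close>.
\<close>
lemma artin_schreier_surjective_if_redundant:
  assumes S: "finite S" "card S \<ge> 2" and indep: "residually_indep S \<mu>"
    and b: "\<And>j. j \<in> S \<Longrightarrow> b j \<in> A" "\<And>j. j \<in> S \<Longrightarrow> b j \<notin> P"
      "\<And>i. 0 < i \<Longrightarrow> i < card S \<Longrightarrow> (\<Sum>j\<in>S. \<mu> j ^ (p ^ i) * b j) = 0"
    and m: "m \<in> S"
    and I: "submodule I" "\<And>x. x \<in> I \<Longrightarrow> x ^ p \<in> I"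
    and c: "\<And>k i. k < n \<Longrightarrow> i < n \<Longrightarrow> c k i \<in> A"
    and redundant: "\<And>t. (\<And>j. j \<in> S - {m} \<Longrightarrow> artin_schreier_image n c I (\<lambda>i. b j * t i)) \<Longrightarrow>
      artin_schreier_image n c I (\<lambda>i. b m * t i)"
    and v: "\<And>i. i < n \<Longrightarrow> v i \<in> I"
  shows "artin_schreier_image n c I v"
proof -
  have m_unit: "\<mu> m \<in> A" "\<mu> m \<noteq> 0" "inverse (\<mu> m) \<in> A"
    using residually_indep_mem[OF indep m] residually_indep_nonmax[OF S(1) indep m]
      nonmax_iff[of "\<mu> m"] by auto
  let ?\<mu>' = "elim \<mu> m" and ?S' = "S - {m}" and ?\<Phi> = "frob_map n c"
  have S': "finite ?S'" "card ?S' = card S - 1" using S m by auto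
  have indep': "residually_indep ?S' ?\<mu>'" by (rule residually_indep_elim[OF S(1) indep m])
  \<comment> \<open>The factor is chosen for the rescaling at the end: if \<open>w\<close> solves
    the equation with \<open>\<mu> m ^ (p - 1)\<close> and right side \<open>u\<close>, then
    \<open>w\<close> divided by \<open>\<mu> m\<close> has Artin-Schreier image
    \<open>v\<close>.\<close>
  define u where "u = (\<lambda>k. \<mu> m ^ p * v k)"
  define U where "U i = (?\<Phi> ^^ i) u" for i :: nat
  have U_Suc: "U (Suc i) k = ?\<Phi> (U i) k" for i k by (simp add: U_def)
  have UI: "k < n \<Longrightarrow> U i k \<in> I" for i k
  proof (induction i arbitrary: k)
    case 0
    then show ?case using v m_unit I by (auto simp: U_def u_def intro: submodule_scale)
  next
    case (Suc i)
    then show ?case unfolding U_Suc frob_map_def using I c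
      by (intro submodule_sum submodule_scale I(2)) auto
  qed
  have "\<exists>z. \<forall>i<card ?S'. (\<Sum>j\<in>?S'. ?\<mu>' j ^ (p ^ i) * z j) = U i k" for k
    using moore_solvable[OF S'(1) indep', of "\<lambda>i. U i k"] .
  then obtain z where z: "\<And>k i. i < card ?S' \<Longrightarrow> (\<Sum>j\<in>?S'. ?\<mu>' j ^ (p ^ i) * z k j) = U i k"
    by metis
  define x where "x j k = z k j" for j k
  have x: "(\<Sum>j\<in>?S'. ?\<mu>' j ^ (p ^ i) * x j k) = U i k" if "i < card ?S'" for i k
    using z[OF that] by (simp add: x_def)
  have xI: "x j k \<in> I" if "j \<in> ?S'" "k < n" for j k
    using moore_submodule[OF S'(1) indep' I(1), of "\<lambda>j. x j k"] x UI that by auto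
  define y where "y j k = ?\<Phi> (x j) k - x j k" for j k
  \<comment> \<open>Semilinearity turns equation \<open>i\<close> for the \<open>x j\<close> into
    equation \<open>Suc i\<close> for their images, as it raises scalars to the p-th power and takes
    \<open>U i\<close> to \<open>U (Suc i)\<close>. So the differences \<open>y j\<close> satisfy
    the same homogeneous equations as the weights \<open>b\<close>.\<close>
  have y: "(\<Sum>j\<in>?S'. ?\<mu>' j ^ (p ^ Suc i) * y j k) = 0" if "Suc i < card ?S'" for i k
  proof -
    have "(\<Sum>j\<in>?S'. ?\<mu>' j ^ (p ^ Suc i) * ?\<Phi> (x j) k) = ?\<Phi> (\<lambda>k. \<Sum>j\<in>?S'. ?\<mu>' j ^ (p ^ i) * x j k) k"
      unfolding frob_map_sum by (simp add: power_mult[symmetric] mult.commute)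
    also have "\<dots> = U (Suc i) k" unfolding U_Suc using x that by (intro frob_map_cong) auto
    also have "\<dots> = (\<Sum>j\<in>?S'. ?\<mu>' j ^ (p ^ Suc i) * x j k)" using x[OF that] by simp
    finally show ?thesis by (simp add: y_def right_diff_distrib sum_subtractf)
  qed
  have b': "(\<Sum>j\<in>?S'. ?\<mu>' j ^ (p ^ Suc i) * b j) = 0" if "Suc i < card ?S'" for i
    using moore_elim[OF S(1) m, of \<mu> "Suc i" b] b(3)[of "Suc i"] b(3)[of "Suc (Suc i)"] that S' by simp
  have "card ?S' > 0" using S' S(2) by simp
  then obtain l where l: "l \<in> ?S'" by (auto simp: card_gt_0_iff)
  have bl: "b l \<noteq> 0" using l b(1,2)[of l] nonmax_iff by auto
  \<comment> \<open>The solutions of these equations form a line: a solution vanishing at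
    \<open>l\<close> solves a homogeneous Moore system on \<open>?S' - {l}\<close>, hence is zero.
    Normalising at \<open>l\<close> therefore gives a \<open>t\<close> common to all
    \<open>j\<close>.\<close>
  define t where "t k = y l k / b l" for k
  have yt: "y j k = b j * t k" if j: "j \<in> ?S'" for j k
  proof (cases "j = l")
    case False
    let ?R = "?S' - {l}"
    have "y j k - b j * t k \<in> {0}"
    proof (rule moore_submodule[where x = "\<lambda>j. y j k - b j * t k"])
      show "residually_indep ?R (\<lambda>j. ?\<mu>' j ^ p)"
        using residually_indep_subset[OF S'(1) residually_indep_frob[OF indep'], of ?R] by auto
      fix i assume "i < card ?R"
      then have i: "Suc i < card ?S'" using l S' by simp
      have "(\<Sum>j\<in>?S'. ?\<mu>' j ^ (p ^ Suc i) * (y j k - b j * t k)) =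
        (\<Sum>j\<in>?S'. ?\<mu>' j ^ (p ^ Suc i) * y j k) - (\<Sum>j\<in>?S'. ?\<mu>' j ^ (p ^ Suc i) * b j) * t k"
        by (simp add: right_diff_distrib sum_subtractf sum_distrib_right mult.assoc)
      also have "\<dots> = 0" using y[OF i] b'[OF i] by simp
      finally show "(\<Sum>j\<in>?R. (?\<mu>' j ^ p) ^ (p ^ i) * (y j k - b j * t k)) \<in> {0}"
        using sum.remove[OF S'(1) l, of "\<lambda>j. ?\<mu>' j ^ (p ^ Suc i) * (y j k - b j * t k)"] bl
        by (simp add: t_def power_mult[symmetric])
    qed (use S' j False submodule_singleton_zero in auto)
    then show ?thesis by simp
  qed (use bl in \<open>simp add: t_def\<close>)
  have "artin_schreier_image n c I (\<lambda>i. b j * t i)" if "j \<in> ?S'" for j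
    unfolding artin_schreier_image_def using xI[OF that] yt[OF that]
    by (intro exI[of _ "x j"]) (auto simp: y_def)
  then obtain xm where xm: "\<And>k. k < n \<Longrightarrow> xm k \<in> I" "\<And>k. k < n \<Longrightarrow> b m * t k = ?\<Phi> xm k - xm k"
    using redundant unfolding artin_schreier_image_def by blast
  define X where "X = x(m := xm)"
  have XI: "X j k \<in> I" if "j \<in> S" "k < n" for j k
    using that xI xm by (simp add: X_def)
  have X: "?\<Phi> (X j) k = X j k + b j * t k" if "j \<in> S" "k < n" for j k
    using that xm(2)[of k] yt[of j k] by (auto simp: X_def y_def algebra_simps)
  define w where "w k = (\<Sum>j\<in>S. \<mu> j * X j k)" for k
  have w: "?\<Phi> w k - \<mu> m ^ (p - 1) * w k = u k" if k: "k < n" for k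
  proof -
    have "?\<Phi> w k = (\<Sum>j\<in>S. \<mu> j ^ p * ?\<Phi> (X j) k)"
      unfolding w_def frob_map_sum ..
    also have "\<dots> = (\<Sum>j\<in>S. \<mu> j ^ p * X j k) + (\<Sum>j\<in>S. \<mu> j ^ p * b j) * t k"
      unfolding sum_distrib_right sum.distrib[symmetric]
      by (intro sum.cong) (auto simp: X k algebra_simps)
    also have "(\<Sum>j\<in>S. \<mu> j ^ p * b j) = 0" using b(3)[of 1] S(2) by simp
    finally have "?\<Phi> w k - \<mu> m ^ (p - 1) * w k = (\<Sum>j\<in>?S'. ?\<mu>' j * X j k)"
      using moore_elim[OF S(1) m, of \<mu> 0 "\<lambda>j. X j k"] by (simp add: w_def[of k])
    also have "\<dots> = (\<Sum>j\<in>?S'. ?\<mu>' j * x j k)"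
      by (intro sum.cong) (auto simp: X_def)
    also have "\<dots> = u k" using x[of 0 k] \<open>card ?S' > 0\<close> by (simp add: U_def)
    finally show ?thesis .
  qed
  have "v i = ?\<Phi> (\<lambda>k. inverse (\<mu> m) * w k) i - inverse (\<mu> m) * w i" if "i < n" for i
    using w[OF that] m_unit power_p_eq[of "\<mu> m"]
    unfolding frob_map_scale[of n c "inverse (\<mu> m)" w i] by (simp add: u_def field_simps)
  moreover have "inverse (\<mu> m) * w i \<in> I" if "i < n" for i
    unfolding w_def using I(1) m_unit XI residually_indep_mem[OF indep] that
    by (intro submodule_scale submodule_sum) auto
  ultimately show ?thesis
    unfolding artin_schreier_image_def by (intro exI[of _ "\<lambda>k. inverse (\<mu> m) * w k"]) blast
qed

end

section \<open>Definability and NIP\<close>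

definition definable_term :: "'a::field set \<Rightarrow> ((nat \<Rightarrow> 'a) \<Rightarrow> 'a) \<Rightarrow> bool" where
  "definable_term B F \<longleftrightarrow> (\<exists>s. \<forall>e. eval_term (valued_field_struct B) e s = F e)"

text \<open>Definability without parameters, stated semantically: formulas are never written out but
  obtained from closure properties.\<close>

definition definable :: "'a::field set \<Rightarrow> ((nat \<Rightarrow> 'a) \<Rightarrow> bool) \<Rightarrow> bool" where
  "definable B Q \<longleftrightarrow> (\<exists>q. \<forall>e. sat (valued_field_struct B) e q \<longleftrightarrow> Q e)"

lemma definable_term_var: "definable_term B (\<lambda>e. e v)"
  unfolding definable_term_def by (rule exI[of _ "Var v"]) simp

lemma definable_term_zero: "definable_term B (\<lambda>e. 0)"
  unfolding definable_term_def by (rule exI[of _ Zero]) (simp add: valued_field_struct_def)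

lemma definable_term_one: "definable_term B (\<lambda>e. 1)"
  unfolding definable_term_def by (rule exI[of _ One]) (simp add: valued_field_struct_def)

lemma definable_term_add:
  assumes "definable_term B F" "definable_term B G"
  shows "definable_term B (\<lambda>e. F e + G e)"
proof -
  obtain s t where "\<forall>e. eval_term (valued_field_struct B) e s = F e"
    "\<forall>e. eval_term (valued_field_struct B) e t = G e"
    using assms unfolding definable_term_def by blast
  then show ?thesis
    unfolding definable_term_def
    by (intro exI[of _ "Add s t"]) (simp add: valued_field_struct_def)
qed

lemma definable_term_mult:
  assumes "definable_term B F" "definable_term B G"
  shows "definable_term B (\<lambda>e. F e * G e)"
proof -
  obtain s t where "\<forall>e. eval_term (valued_field_struct B) e s = F e"
    "\<forall>e. eval_term (valued_field_struct B) e t = G e"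
    using assms unfolding definable_term_def by blast
  then show ?thesis
    unfolding definable_term_def
    by (intro exI[of _ "Mul s t"]) (simp add: valued_field_struct_def)
qed

lemma definable_term_uminus:
  assumes "definable_term B F"
  shows "definable_term B (\<lambda>e. - F e)"
proof -
  obtain s where "\<forall>e. eval_term (valued_field_struct B) e s = F e"
    using assms unfolding definable_term_def by blast
  then show ?thesis
    unfolding definable_term_def
    by (intro exI[of _ "Neg s"]) (simp add: valued_field_struct_def)
qed

lemma definable_term_diff:
  "definable_term B F \<Longrightarrow> definable_term B G \<Longrightarrow> definable_term B (\<lambda>e. F e - G e)"
  using definable_term_add[OF _ definable_term_uminus] by fastforce

lemma definable_term_power: "definable_term B F \<Longrightarrow> definable_term B (\<lambda>e. F e ^ k)"
  by (induction k) (auto intro: definable_term_one definable_term_mult)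

lemma definable_term_sum:
  "(\<And>i. i \<in> S \<Longrightarrow> definable_term B (F i)) \<Longrightarrow> definable_term B (\<lambda>e. \<Sum>i\<in>S. F i e)"
  by (induction S rule: infinite_finite_induct)
    (auto intro: definable_term_zero definable_term_add)

lemmas definable_term_intros = definable_term_var definable_term_zero definable_term_one
  definable_term_add definable_term_mult definable_term_diff definable_term_power
  definable_term_sum

lemma definable_eq:
  assumes "definable_term B F" "definable_term B G"
  shows "definable B (\<lambda>e. F e = G e)"
proof -
  obtain s t where "\<forall>e. eval_term (valued_field_struct B) e s = F e"
    "\<forall>e. eval_term (valued_field_struct B) e t = G e"
    using assms unfolding definable_term_def by blast
  then show ?thesis
    unfolding definable_def by (intro exI[of _ "FEq s t"]) simp
qed

lemma definable_mem:
  assumes "definable_term B F"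
  shows "definable B (\<lambda>e. F e \<in> B)"
proof -
  obtain s where "\<forall>e. eval_term (valued_field_struct B) e s = F e"
    using assms unfolding definable_term_def by blast
  then show ?thesis
    unfolding definable_def by (intro exI[of _ "InO s"]) (simp add: valued_field_struct_def)
qed

lemma definable_not: "definable B Q \<Longrightarrow> definable B (\<lambda>e. \<not> Q e)"
  unfolding definable_def by (metis sat.simps(3))

lemma definable_conj: "definable B Q \<Longrightarrow> definable B R \<Longrightarrow> definable B (\<lambda>e. Q e \<and> R e)"
  unfolding definable_def by (metis sat.simps(4))

lemma definable_True: "definable B (\<lambda>e. True)"
  using definable_eq[OF definable_term_zero definable_term_zero] by simp

lemma definable_all_less:
  fixes n :: nat
  assumes "\<And>i. i < n \<Longrightarrow> definable B (Q i)"
  shows "definable B (\<lambda>e. \<forall>i<n. Q i e)"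
  using assms
proof (induction n)
  case (Suc n)
  then have "definable B (\<lambda>e. Q n e \<and> (\<forall>i<n. Q i e))"
    by (intro definable_conj) auto
  then show ?case by (simp add: All_less_Suc)
qed (simp add: definable_True)

lemma definable_ex:
  assumes "definable B Q"
  shows "definable B (\<lambda>e. \<exists>x. Q (e(v := x)))"
proof -
  obtain q where "\<forall>e. sat (valued_field_struct B) e q \<longleftrightarrow> Q e"
    using assms unfolding definable_def by blast
  then show ?thesis
    unfolding definable_def
    by (intro exI[of _ "FEx v q"]) (simp add: valued_field_struct_def)
qed

lemma definable_ex_set:
  assumes "finite V" "definable B Q"
  shows "definable B (\<lambda>e. \<exists>y. Q (override_on e y V))"
  using assms
proof (induction V arbitrary: Q rule: finite_induct)
  case (insert v V)
  have "definable B (\<lambda>e. \<exists>y. \<exists>x. Q ((override_on e y V)(v := x)))"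
    using insert.IH[OF definable_ex[OF insert.prems]] .
  moreover have "(\<exists>y. \<exists>x. Q ((override_on e y V)(v := x))) \<longleftrightarrow> (\<exists>y. Q (override_on e y (insert v V)))" for e
  proof
    assume "\<exists>y. \<exists>x. Q ((override_on e y V)(v := x))"
    then obtain y x where "Q ((override_on e y V)(v := x))" by blast
    moreover have "(override_on e y V)(v := x) = override_on e (y(v := x)) (insert v V)"
      using insert.hyps by (auto simp: override_on_def)
    ultimately show "\<exists>y. Q (override_on e y (insert v V))" by metis
  next
    assume "\<exists>y. Q (override_on e y (insert v V))"
    then show "\<exists>y. \<exists>x. Q ((override_on e y V)(v := x))"
      by (metis override_on_insert)
  qed
  ultimately show ?case by simp
qed simp

definition definable_set :: "'a::field set \<Rightarrow> 'a set \<Rightarrow> bool" where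
  "definable_set B I \<longleftrightarrow> (\<forall>v. definable B (\<lambda>e. e v \<in> I))"

lemma definable_set_UNIV: "definable_set B UNIV"
  by (simp add: definable_set_def definable_True)

lemma definable_set_maximal_ideal: "definable_set B (maximal_ideal B)"
  unfolding definable_set_def
proof
  fix v
  \<comment> \<open>\<open>Suc v\<close> merely serves as a bound variable different from
    \<open>v\<close>.\<close>
  have "definable B (\<lambda>e. \<exists>x. (e(Suc v := x)) (Suc v) \<in> B \<and> (e(Suc v := x)) v * (e(Suc v := x)) (Suc v) = 1)"
    by (intro definable_ex definable_conj definable_mem definable_eq definable_term_intros)
  then have "definable B (\<lambda>e. e v \<in> B \<and> \<not> (\<exists>x. x \<in> B \<and> e v * x = 1))"
    by (intro definable_conj definable_mem definable_term_intros definable_not) simp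
  then show "definable B (\<lambda>e. e v \<in> maximal_ideal B)"
    by (simp add: maximal_ideal_def Ball_def)
qed

context char_p_valued_field
begin

section \<open>The images as a uniformly definable family of subgroups\<close>

lemma artin_schreier_image_diff:
  assumes "submodule I" "artin_schreier_image n c I s" "artin_schreier_image n c I t"
  shows "artin_schreier_image n c I (\<lambda>i. s i - t i)"
proof -
  obtain x y where "\<And>i. i < n \<Longrightarrow> x i \<in> I \<and> s i = frob_map n c x i - x i"
    "\<And>i. i < n \<Longrightarrow> y i \<in> I \<and> t i = frob_map n c y i - y i"
    using assms(2,3) unfolding artin_schreier_image_def by blast
  moreover have "frob_map n c (\<lambda>k. x k - y k) i = frob_map n c x i - frob_map n c y i" for i
    using frob_map_add[of n c "\<lambda>k. x k - y k" y i] by simp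
  ultimately show ?thesis
    unfolding artin_schreier_image_def
    by (intro exI[of _ "\<lambda>k. x k - y k"]) (simp add: submodule_diff[OF assms(1)])
qed

lemma artin_schreier_image_zero: "submodule I \<Longrightarrow> artin_schreier_image n c I (\<lambda>i. 0)"
  unfolding artin_schreier_image_def
  using p_pos by (intro exI[of _ "\<lambda>k. 0"]) (simp add: frob_map_def zero_power)

lemma artin_schreier_image_add:
  assumes "submodule I" "artin_schreier_image n c I s" "artin_schreier_image n c I t"
  shows "artin_schreier_image n c I (\<lambda>i. s i + t i)"
  using artin_schreier_image_diff[OF assms(1,2)
      artin_schreier_image_diff[OF assms(1) artin_schreier_image_zero[OF assms(1)] assms(3)]] by simp

lemma artin_schreier_image_sum:
  assumes "submodule I" "\<And>j. j \<in> S \<Longrightarrow> artin_schreier_image n c I (s j)"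
  shows "artin_schreier_image n c I (\<lambda>i. \<Sum>j\<in>S. s j i)"
  using assms(2)
  by (induction S rule: infinite_finite_induct)
    (simp_all add: artin_schreier_image_zero artin_schreier_image_add assms(1))

text \<open>
  Variables: \<open>(0, i)\<close> stands for \<open>t\<^sub>i\<close>, \<open>(1, i)\<close> for the bound \<open>y\<^sub>i\<close>, \<open>(2, 0)\<close> for \<open>b\<close>, and
  \<open>(k + 3, i)\<close> for the coefficient \<open>c\<^sub>k\<^sub>i\<close>.
\<close>
lemma definable_artin_schreier_image:
  assumes "definable_set B I"
  shows "definable B (\<lambda>e. artin_schreier_image n (\<lambda>k i. e (prod_encode (k + 3, i))) I
    (\<lambda>i. e (prod_encode (2, 0)) * e (prod_encode (0, i))))"
proof -
  let ?V = "(\<lambda>i. prod_encode (1, i)) ` {..<n}"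
  define Q where "Q e \<longleftrightarrow> (\<forall>i<n. e (prod_encode (1, i)) \<in> I) \<and>
     (\<forall>i<n. e (prod_encode (2, 0)) * e (prod_encode (0, i)) =
       (\<Sum>k<n. e (prod_encode (k + 3, i)) * e (prod_encode (1, k)) ^ p) - e (prod_encode (1, i)))"
    for e :: "nat \<Rightarrow> 'a"
  have "definable B Q"
    unfolding Q_def using assms unfolding definable_set_def
    by (intro definable_conj definable_all_less definable_eq definable_term_intros) auto
  then have "definable B (\<lambda>e. \<exists>y. Q (override_on e y ?V))"
    by (intro definable_ex_set) auto
  moreover have "(\<exists>y. Q (override_on e y ?V)) \<longleftrightarrow>
    artin_schreier_image n (\<lambda>k i. e (prod_encode (k + 3, i))) I
      (\<lambda>i. e (prod_encode (2, 0)) * e (prod_encode (0, i)))" for e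
  proof -
    have Q: "Q (override_on e y ?V) \<longleftrightarrow> (\<forall>i<n. y (prod_encode (1, i)) \<in> I) \<and>
      (\<forall>i<n. e (prod_encode (2, 0)) * e (prod_encode (0, i)) =
       (\<Sum>k<n. e (prod_encode (k + 3, i)) * y (prod_encode (1, k)) ^ p) - y (prod_encode (1, i)))" for y
      unfolding Q_def by (auto simp: override_on_def image_iff prod_encode_eq)
    show ?thesis
    proof
      assume "\<exists>y. Q (override_on e y ?V)"
      then obtain y where "Q (override_on e y ?V)" by blast
      then show "artin_schreier_image n (\<lambda>k i. e (prod_encode (k + 3, i))) I
          (\<lambda>i. e (prod_encode (2, 0)) * e (prod_encode (0, i)))"
        unfolding Q artin_schreier_image_def frob_map_def
        by (intro exI[of _ "\<lambda>i. y (prod_encode (1, i))"])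
    next
      assume "artin_schreier_image n (\<lambda>k i. e (prod_encode (k + 3, i))) I
          (\<lambda>i. e (prod_encode (2, 0)) * e (prod_encode (0, i)))"
      then obtain y where "(\<forall>i<n. y i \<in> I) \<and> (\<forall>i<n. e (prod_encode (2, 0)) * e (prod_encode (0, i)) =
          frob_map n (\<lambda>k i. e (prod_encode (k + 3, i))) y i - y i)"
        unfolding artin_schreier_image_def by blast
      then show "\<exists>y. Q (override_on e y ?V)"
        unfolding Q frob_map_def by (intro exI[of _ "\<lambda>v. y (snd (prod_decode v))"]) simp
    qed
  qed
  ultimately show ?thesis by simp
qed

text \<open>
  The Baldwin--Saxl chain condition: if no subgroup were redundant, sums of witnesses would give the
  independence property.
\<close>
lemma NIP_redundant:
  assumes NIP: "NIP_theory TYPE('a) (complete_theory (valued_field_struct B))"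
    and I: "definable_set B I" "submodule I"
  shows "\<exists>N\<ge>2::nat. \<forall>b. \<exists>m<N. \<forall>t. (\<forall>j<N. j \<noteq> m \<longrightarrow> artin_schreier_image n c I (\<lambda>i. b j * t i)) \<longrightarrow>
    artin_schreier_image n c I (\<lambda>i. b m * t i)"
proof (rule ccontr)
  let ?M = "valued_field_struct B" and ?X = "{prod_encode (2, 0)}"
  let ?H = "\<lambda>b t. artin_schreier_image n c I (\<lambda>i. b * t i)"
  assume contra: "\<not> ?thesis"
  obtain q where q: "\<And>e. sat ?M e q \<longleftrightarrow>
      artin_schreier_image n (\<lambda>k i. e (prod_encode (k + 3, i))) I
        (\<lambda>i. e (prod_encode (2, 0)) * e (prod_encode (0, i)))"
    using definable_artin_schreier_image[OF I(1), of n] unfolding definable_def by blast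
  have univ: "univ_of ?M = UNIV" by (simp add: valued_field_struct_def)
  \<comment> \<open>The subgroups are indexed by the variable for \<open>b\<close> alone;
    \<open>t\<close> and the coefficients \<open>c\<close> go into the other tuple. The negation is
    there because the witness for the index \<open>m\<close> lies outside the subgroup with that
    index.\<close>
  have "has_IP ?M (FNot q) ?X"
    unfolding has_IP_def
  proof
    fix N :: nat
    \<comment> \<open>Taking \<open>N + 2\<close> members meets the bound 2 for every
      \<open>N\<close>; the pattern is then read off from the first \<open>N\<close>.\<close>
    have "\<exists>b. \<forall>m<N+2. \<exists>t. (\<forall>j<N+2. j \<noteq> m \<longrightarrow> ?H (b j) t) \<and> \<not> ?H (b m) t"
      using contra[simplified not_ex de_Morgan_conj, rule_format, of "N + 2"] by simp
    then obtain b where "\<forall>m\<in>{..<N+2}. \<exists>t. (\<forall>j<N+2. j \<noteq> m \<longrightarrow> ?H (b j) t) \<and> \<not> ?H (b m) t"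
      by auto
    from bchoice[OF this] obtain \<tau> where
      *: "\<forall>m\<in>{..<N+2}. (\<forall>j<N+2. j \<noteq> m \<longrightarrow> ?H (b j) (\<tau> m)) \<and> \<not> ?H (b m) (\<tau> m)" ..
    then have \<tau>: "?H (b j) (\<tau> m)" if "j < N + 2" "m < N + 2" "j \<noteq> m" for j m
      using that by simp
    have not_\<tau>: "\<not> ?H (b m) (\<tau> m)" if "m < N + 2" for m
      using * that by simp
    define \<alpha> where "\<alpha> j v = b j" for j v :: nat
    define \<beta> where "\<beta> S v = (case prod_decode v of (k, i) \<Rightarrow>
      if k = 0 then \<Sum>m\<in>S. \<tau> m i else c (k - 3) i)" for S v
    have sat: "sat_partitioned ?M (FNot q) ?X (\<alpha> j) (\<beta> S) \<longleftrightarrow> \<not> ?H (b j) (\<lambda>i. \<Sum>m\<in>S. \<tau> m i)"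
      for j S
      by (simp add: sat_partitioned_def q \<alpha>_def \<beta>_def prod_encode_eq)
    \<comment> \<open>Modulo the subgroup with index \<open>j\<close> the sum is
      \<open>\<tau> j\<close> if \<open>j\<close> belongs to \<open>S\<close>, and 0
      otherwise.\<close>
    have "\<not> ?H (b j) (\<lambda>i. \<Sum>m\<in>S. \<tau> m i) \<longleftrightarrow> j \<in> S" if j: "j < N" and S: "S \<subseteq> {..<N}" for j S
    proof -
      have fin: "finite S" using S finite_subset by blast
      have "?H (b j) (\<lambda>i. \<Sum>m\<in>S-{j}. \<tau> m i)"
        unfolding sum_distrib_left using S j by (intro artin_schreier_image_sum[OF I(2)] \<tau>) auto
      moreover have "(\<lambda>i. b j * \<tau> j i) = (\<lambda>i. b j * (\<Sum>m\<in>S. \<tau> m i) - b j * (\<Sum>m\<in>S-{j}. \<tau> m i))" if "j \<in> S"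
        by (simp add: sum.remove[OF fin that] algebra_simps)
      ultimately show ?thesis
        using not_\<tau>[of j] artin_schreier_image_diff[OF I(2), of n c "\<lambda>i. b j * (\<Sum>m\<in>S. \<tau> m i)"] j
        by (cases "j \<in> S") auto
    qed
    then show "\<exists>a b. (\<forall>i. range (a i) \<subseteq> univ_of ?M) \<and> (\<forall>S. range (b S) \<subseteq> univ_of ?M) \<and>
        (\<forall>i<N. \<forall>S\<subseteq>{..<N}. sat_partitioned ?M (FNot q) ?X (a i) (b S) \<longleftrightarrow> i \<in> S)"
      by (intro exI[of _ \<alpha>] exI[of _ \<beta>]) (simp add: sat univ)
  qed
  moreover have "is_model ?M (complete_theory ?M)"
    by (intro is_model_complete_theory is_struct_valued_field_struct)
  ultimately show False using NIP unfolding NIP_theory_def by blast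
qed

text \<open>The predicate \<open>B\<close> and the scalars \<open>A\<close> are independent of each
  other, which allows \<open>A = UNIV\<close> while \<open>B\<close> is a proper valuation
  ring.\<close>

lemma NIP_artin_schreier_surjective:
  assumes NIP: "NIP_theory TYPE('a) (complete_theory (valued_field_struct B))"
    and I: "definable_set B I" "submodule I" "\<And>x. x \<in> I \<Longrightarrow> x ^ p \<in> I"
    and "residue_field_infinite"
    and c: "\<And>k i. k < n \<Longrightarrow> i < n \<Longrightarrow> c k i \<in> A"
    and v: "\<And>i. i < n \<Longrightarrow> v i \<in> I"
  shows "artin_schreier_image n c I v"
proof -
  obtain N :: nat where N: "N \<ge> 2" "\<And>b. \<exists>m<N. \<forall>t. (\<forall>j<N. j \<noteq> m \<longrightarrow> artin_schreier_image n c I (\<lambda>i. b j * t i)) \<longrightarrow>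
    artin_schreier_image n c I (\<lambda>i. b m * t i)"
    using NIP_redundant[OF NIP I(1,2)] by blast
  let ?S = "{..<N}"
  obtain \<mu> where \<mu>: "residually_indep ?S \<mu>"
    using residually_indep_exists[OF assms(5), of ?S] by auto
  have "?S \<noteq> {}" using N(1) by (auto simp: lessThan_empty_iff)
  then obtain b where b: "\<And>j. j \<in> ?S \<Longrightarrow> b j \<in> A" "\<And>j. j \<in> ?S \<Longrightarrow> b j \<notin> P"
      "\<And>i. 0 < i \<Longrightarrow> i < card ?S \<Longrightarrow> (\<Sum>j\<in>?S. \<mu> j ^ (p ^ i) * b j) = 0"
    using dual_weights[OF finite_lessThan \<mu>] by blast
  obtain m where m: "m \<in> ?S" "\<And>t. (\<And>j. j \<in> ?S - {m} \<Longrightarrow> artin_schreier_image n c I (\<lambda>i. b j * t i)) \<Longrightarrow>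
      artin_schreier_image n c I (\<lambda>i. b m * t i)"
    using N(2)[of b] by auto
  show ?thesis
    using N(1) by (intro artin_schreier_surjective_if_redundant[OF _ _ \<mu> b m(1) I(2,3) c m(2) v]) auto
qed

end

section \<open>Infinite residue field\<close>

lemma valuation_ring_UNIV: "valuation_ring UNIV"
  by (simp add: valuation_ring_def)

lemma maximal_ideal_UNIV: "maximal_ideal (UNIV :: 'a::field set) = {0}"
  by (auto simp: maximal_ideal_def intro: right_inverse)

context char_p_valued_field
begin

lemma infinite_if_nontrivial:
  assumes "P \<noteq> {0}" shows "infinite (UNIV :: 'a set)"
proof -
  obtain \<pi> where \<pi>: "\<pi> \<in> P" "\<pi> \<noteq> 0" using assms zero_max by blast
  have "inj (\<lambda>n. \<pi> ^ n)"
  proof (rule injI)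
    fix m n :: nat assume "\<pi> ^ m = \<pi> ^ n"
    then show "m = n"
    proof (induction m n rule: linorder_wlog)
      case (le m n)
      have "\<pi> ^ m * \<pi> ^ (n - m) = \<pi> ^ n"
        using le(1) by (simp flip: power_add)
      with le(2) have "\<pi> ^ (n - m) = 1" using \<pi> by simp
      then show ?case using max_power[OF \<pi>(1), of "n - m"] le(1) by fastforce
    qed simp
  qed
  then show ?thesis by (rule infinite_super[OF subset_UNIV range_inj_infinite])
qed

lemma artin_schreier_closed:
  fixes B :: "'a set"
  assumes NIP: "NIP_theory TYPE('a) (complete_theory (valued_field_struct B))"
    and "infinite (UNIV :: 'a set)"
  shows "\<exists>x::'a. x ^ p - x = a"
proof -
  interpret K: char_p_valued_field "UNIV :: 'a set" p
    by unfold_locales (simp_all add: valuation_ring_UNIV p_char[symmetric] p_pos)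
  have "K.residue_field_infinite"
    unfolding K.residue_field_infinite_def maximal_ideal_UNIV
    using ex_new_if_finite[OF assms(2)] by (metis UNIV_I eq_iff_diff_eq_0 singletonD)
  then have "K.artin_schreier_image 1 (\<lambda>_ _. 1) UNIV (\<lambda>_. a)"
    by (intro K.NIP_artin_schreier_surjective[OF NIP] definable_set_UNIV K.submodule_ring) auto
  then show ?thesis by (auto simp: K.artin_schreier_image_def K.frob_map_def)
qed

text \<open>The map \<open>x ^ p - x\<close> is onto the residue field. On a finite residue field it
  would then be injective, yet it takes the same value at 0 and 1.\<close>

lemma residue_field_infinite_if_artin_schreier_closed:
  assumes AS: "\<And>a::'a. \<exists>x. x ^ p - x = a"
  shows residue_field_infinite
proof (rule ccontr)
  assume "\<not> ?thesis"
  then have "\<exists>F. finite F \<and> (\<forall>x\<in>A. \<exists>f\<in>F. x - f \<in> P)"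
    by (simp add: residue_field_infinite_def)
  then obtain F where F: "finite F" "\<forall>x\<in>A. \<exists>f\<in>F. x - f \<in> P" by (elim exE conjE)
  define cls where "cls x = {y. y - x \<in> P}" for x
  have cls_eq: "cls x = cls y \<longleftrightarrow> x - y \<in> P" for x y
  proof
    assume "cls x = cls y"
    moreover have "x \<in> cls x" by (simp add: cls_def)
    ultimately show "x - y \<in> P" by (simp add: cls_def)
  next
    assume *: "x - y \<in> P"
    show "cls x = cls y"
      using max_add[OF _ *] max_diff[OF _ *] by (fastforce simp: cls_def)
  qed
  have "cls ` A \<subseteq> cls ` F" using F(2) cls_eq by blast
  then have fin: "finite (cls ` A)" using F(1) finite_subset by blast
  define G where "G C = {y. \<exists>x\<in>C. y - (x ^ p - x) \<in> P}" for C
  have G: "G (cls x) = cls (x ^ p - x)" for x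
  proof (intro set_eqI iffI)
    fix y assume "y \<in> G (cls x)"
    then obtain z where z: "z - x \<in> P" "y - (z ^ p - z) \<in> P" by (auto simp: G_def cls_def)
    then have "(z - x) ^ p - (z - x) \<in> P" using p_pos max_diff max_power by blast
    from max_add[OF z(2) this] show "y \<in> cls (x ^ p - x)"
      by (simp add: cls_def frob_diff algebra_simps)
  next
    fix y assume y: "y \<in> cls (x ^ p - x)"
    have "x \<in> cls x" by (simp add: cls_def)
    with y show "y \<in> G (cls x)" unfolding G_def cls_def by blast
  qed
  have "cls ` A \<subseteq> G ` (cls ` A)"
  proof
    fix C assume "C \<in> cls ` A"
    then obtain a where a: "a \<in> A" "C = cls a" by blast
    obtain x where x: "x ^ p - x = a" using AS by blast
    have "x \<in> A"
    proof (rule ccontr)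
      assume "x \<notin> A"
      then have i: "inverse x \<in> P" "x \<noteq> 0" using inverse_max by auto
      \<comment> \<open>The equation for \<open>x\<close>, divided by \<open>x ^ p\<close>. As
        \<open>p > 1\<close>, both summands contain a factor from \<open>P\<close>.\<close>
      have "1 = inverse x ^ (p - 1) + a * inverse x ^ p"
        using i(2) unfolding x[symmetric] power_p_eq by (simp add: field_simps)
      also have "\<dots> \<in> P"
        using i(1) a p_gt_1 by (intro max_add max_mult max_power) auto
      finally show False by simp
    qed
    then show "C \<in> G ` (cls ` A)" using G[of x] x a by auto
  qed
  moreover from finite_surj[OF fin] have "inj_on G (cls ` A)" if "cls ` A \<subseteq> G ` (cls ` A)"
    using that fin by (metis card_image_le card_mono eq_card_imp_inj_on finite_imageI le_antisym)
  moreover have "G (cls 0) = G (cls 1)" using p_pos by (simp add: G zero_power)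
  ultimately have "cls 0 = cls 1" by (meson imageI inj_onD one_mem zero_mem)
  then have "- 1 \<in> P" by (simp add: cls_eq)
  then show False using max_uminus by fastforce
qed

end

section \<open>Lifting simple roots\<close>

lemma poly_mod_sum_left: "(\<Sum>i\<in>S. f i) mod g = (\<Sum>i\<in>S. f i mod g)" for g :: "'a::field poly"
  by (induction S rule: infinite_finite_induct) (simp_all add: poly_mod_add_left)

context valued_field
begin

section \<open>Polynomials over the valuation ring modulo a monic polynomial\<close>

definition coeffs_in :: "'a set \<Rightarrow> 'a poly \<Rightarrow> bool" where
  "coeffs_in W q \<longleftrightarrow> (\<forall>i. coeff q i \<in> W)"

lemma coeffs_in_add: "submodule W \<Longrightarrow> coeffs_in W q \<Longrightarrow> coeffs_in W r \<Longrightarrow> coeffs_in W (q + r)"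
  and coeffs_in_diff: "submodule W \<Longrightarrow> coeffs_in W q \<Longrightarrow> coeffs_in W r \<Longrightarrow> coeffs_in W (q - r)"
  and coeffs_in_smult: "submodule W \<Longrightarrow> a \<in> A \<Longrightarrow> coeffs_in W q \<Longrightarrow> coeffs_in W (smult a q)"
  and coeffs_in_monom: "submodule W \<Longrightarrow> a \<in> W \<Longrightarrow> coeffs_in W (monom a n)"
  by (simp_all add: coeffs_in_def submodule_add submodule_diff submodule_scale)

lemma coeffs_in_pCons: "coeffs_in W (pCons a q) \<longleftrightarrow> a \<in> W \<and> coeffs_in W q"
  unfolding coeffs_in_def by (metis coeff_pCons_0 coeff_pCons_Suc not0_implies_Suc)

lemma coeffs_in_mult: "submodule W \<Longrightarrow> coeffs_in A q \<Longrightarrow> coeffs_in W r \<Longrightarrow> coeffs_in W (q * r)"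
  unfolding coeffs_in_def coeff_mult by (intro allI submodule_sum submodule_scale) auto

lemma coeffs_in_zero: "submodule W \<Longrightarrow> coeffs_in W 0"
  by (simp add: coeffs_in_def)

lemma coeffs_in_uminus: "submodule W \<Longrightarrow> coeffs_in W q \<Longrightarrow> coeffs_in W (- q)"
  using coeffs_in_diff[of W 0 q] by (simp add: coeffs_in_zero)

lemma coeffs_in_one: "coeffs_in A 1"
  by (simp add: coeffs_in_def coeff_1)

lemma coeffs_in_power: "coeffs_in A q \<Longrightarrow> coeffs_in A (q ^ n)"
  by (induction n) (simp_all add: coeffs_in_mult submodule_ring coeffs_in_one)

lemma coeffs_in_sum:
  "submodule W \<Longrightarrow> (\<And>i. i \<in> S \<Longrightarrow> coeffs_in W (f i)) \<Longrightarrow> coeffs_in W (sum f S)"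
  by (simp add: coeffs_in_def coeff_sum submodule_sum)

lemma coeffs_in_max_imp: "coeffs_in P q \<Longrightarrow> coeffs_in A q"
  by (simp add: coeffs_in_def max_imp_mem)

lemma coeffs_in_pcompose: "coeffs_in A f \<Longrightarrow> coeffs_in A q \<Longrightarrow> coeffs_in A (pcompose f q)"
proof (induction f)
  case (pCons a f)
  then show ?case
    unfolding pcompose_pCons coeffs_in_pCons
    by (intro coeffs_in_add coeffs_in_mult submodule_ring) (auto simp: coeffs_in_pCons coeffs_in_zero submodule_ring)
qed (simp add: coeffs_in_def)

text \<open>Division by a monic polynomial needs no division of coefficients: each step subtracts a
  multiple of \<open>g\<close> by the coefficient at \<open>degree g\<close>.\<close>

lemma coeffs_in_mod:
  assumes W: "submodule W" and g: "coeffs_in A g" "lead_coeff g = 1" and "coeffs_in W q"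
  shows "coeffs_in W (q mod g)"
  using assms(4)
proof (induction q)
  case (pCons a q)
  have "g \<noteq> 0" using g(2) by auto
  have *: "coeffs_in W (pCons a (q mod g))" using pCons by (simp add: coeffs_in_pCons)
  then have "coeff (pCons a (q mod g)) (degree g) \<in> W" by (simp add: coeffs_in_def)
  then have "coeffs_in W (smult (coeff (pCons a (q mod g)) (degree g)) g)"
    using g(1) W by (simp add: coeffs_in_def submodule_scale mult.commute)
  then show ?case
    using * W \<open>g \<noteq> 0\<close> g(2) by (simp add: mod_pCons coeffs_in_diff del: coeff_pCons)
qed simp

text \<open>The chosen index is one of minimal valuation; this serves to scale a polynomial to a
  primitive one.\<close>

lemma coeff_divides_all:
  assumes "finite S" "S \<noteq> {}"
  shows "\<exists>i\<in>S. \<forall>j\<in>S. \<exists>a\<in>A. f j = a * f i"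
  using assms
proof (induction S rule: finite_ne_induct)
  case (singleton x)
  then show ?case by (auto intro: bexI[of _ 1])
next
  case (insert x S)
  then obtain i where i: "i \<in> S" "\<And>j. j \<in> S \<Longrightarrow> \<exists>a\<in>A. f j = a * f i" by auto
  consider "\<exists>a\<in>A. f x = a * f i" | a where "a \<in> A" "f i = a * f x"
  proof -
    consider "f x = 0" | "f i = 0" | "f i \<noteq> 0" "f x \<noteq> 0" "f x / f i \<in> A"
      | "f i \<noteq> 0" "f x \<noteq> 0" "f i / f x \<in> A"
      using mem_or_inverse_mem[of "f x / f i"] by auto
    then show thesis
    proof cases
      case 1
      then have "f x = 0 * f i" by simp
      then show ?thesis using that(1) zero_mem by blast
    next
      case 2
      then show ?thesis using that(2)[of 0] by simp
    next
      case 3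
      then show ?thesis using that(1) by (metis nonzero_eq_divide_eq)
    next
      case 4
      then show ?thesis using that(2)[of "f i / f x"] by simp
    qed
  qed
  then show ?case
  proof cases
    case 1
    then show ?thesis using i by (intro bexI[of _ i]) auto
  next
    case (2 a)
    have "\<exists>b\<in>A. f j = b * f x" if "j \<in> insert x S" for j
    proof (cases "j = x")
      case False
      with that have "j \<in> S" by simp
      from i(2)[OF this] obtain b where "b \<in> A" "f j = b * f i" ..
      then show ?thesis using 2 by (intro bexI[of _ "b * a"]) (simp_all add: mult_mem)
    qed (auto intro: bexI[of _ 1])
    then show ?thesis by (intro bexI[of _ x]) auto
  qed
qed

end

context char_p_valued_field
begin

lemma poly_frob_sum: "(sum f S :: 'a poly) ^ p = (\<Sum>i\<in>S. f i ^ p)"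
  using freshmans_dream_sum[where ?'a = "'a poly" and n = p and f = f and A = S] prime_p p_char by simp

lemma poly_frob_diff: "(q - r :: 'a poly) ^ p = q ^ p - r ^ p"
  using freshmans_dream[where ?'a = "'a poly" and n = p and x = "q - r" and y = r] prime_p p_char by simp

lemma monom_power: "monom (a :: 'a) i ^ n = monom (a ^ n) (n * i)"
  by (induction n) (simp_all add: mult_monom one_poly_eq_simps monom_0)

text \<open>
  Modulo the maximal ideal the polynomial is \<open>z\<^sup>k (z - 1)\<close>, and \<open>z\<^sup>k\<close> is an idempotent of the
  quotient by it. Surjectivity of the Artin--Schreier map lifts this idempotent; the lift generates
  a free module of rank one, on which \<open>z\<close> acts as multiplication by the root.
\<close>
lemma root_if_artin_schreier_surjective:
  fixes r :: "'a poly" and k :: nat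
  defines "g \<equiv> monom 1 (Suc k) - monom 1 k + r"
  assumes AS: "\<And>c v. (\<And>i j. i < Suc k \<Longrightarrow> j < Suc k \<Longrightarrow> c i j \<in> A) \<Longrightarrow> (\<And>i. i < Suc k \<Longrightarrow> v i \<in> P) \<Longrightarrow>
      artin_schreier_image (Suc k) c P v"
    and r: "degree r < Suc k" "coeffs_in P r"
  shows "\<exists>z. poly g z = 0 \<and> z - 1 \<in> P"
proof -
  have dg: "degree (r - monom 1 k) < Suc k"
    using r(1) by (intro degree_diff_less) (auto simp: degree_monom_eq)
  have g_eq: "g = monom 1 (Suc k) + (r - monom 1 k)" by (simp add: g_def)
  have deg: "degree g = Suc k"
    unfolding g_eq using dg by (subst degree_add_eq_left) (auto simp: degree_monom_eq)
  have lc: "lead_coeff g = 1"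
    unfolding deg using dg by (simp add: g_eq coeff_eq_0 del: coeff_diff)
  have gA: "coeffs_in A g"
    unfolding g_def using r(2)
    by (intro coeffs_in_add coeffs_in_diff coeffs_in_monom submodule_ring coeffs_in_max_imp) auto
  have g0: "g \<noteq> 0" using deg by auto
  note modP = coeffs_in_mod[OF submodule_max gA lc]
  \<comment> \<open>For integral polynomials this is equality in the quotient by \<open>g\<close>
    and the maximal ideal, where \<open>g\<close> becomes \<open>z ^ Suc k - z ^ k\<close>; there
    all powers of \<open>z\<close> from \<open>k\<close> on coincide.\<close>
  define cg where "cg q s \<longleftrightarrow> coeffs_in P ((q - s) mod g)" for q s
  have cg_trans: "cg q t" if "cg q s" "cg s t" for q s t
    using coeffs_in_add[OF submodule_max that[unfolded cg_def]]
    by (simp add: cg_def poly_mod_add_left[symmetric])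
  have cg_diff: "cg (q - q') (s - s')" if "cg q s" "cg q' s'" for q s q' s'
    using coeffs_in_diff[OF submodule_max that[unfolded cg_def]]
    by (simp add: cg_def poly_mod_diff_left[symmetric] algebra_simps)
  have cg_refl: "cg q q" for q by (simp add: cg_def coeffs_in_def)
  have cg_mult: "cg (t * q) (t * s)" if "cg q s" "coeffs_in A t" for q s t
  proof -
    have "(t * q - t * s) mod g = (t * ((q - s) mod g)) mod g"
      by (simp add: mod_mult_right_eq right_diff_distrib)
    then show ?thesis
      using that unfolding cg_def by (auto intro!: modP coeffs_in_mult submodule_max)
  qed
  have cg_if: "cg q s" if "coeffs_in P (q - s)" for q s
    using modP[OF that] by (simp add: cg_def)
  have cg_mod: "cg q s" if "g dvd q - s" for q s
    using that by (simp add: cg_def coeffs_in_def mod_eq_0_iff_dvd)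
  let ?x = "monom (1::'a)"
  have xA: "coeffs_in A (?x i)" for i by (intro coeffs_in_monom submodule_ring) simp
  have cg_step: "cg (?x (Suc (k + i))) (?x (k + i))" for i
  proof -
    have "?x (Suc (k + i)) - ?x (k + i) - (- (?x i * r)) = ?x i * g"
      by (simp add: g_def algebra_simps mult_monom)
    then have "cg (?x (Suc (k + i)) - ?x (k + i)) (- (?x i * r))"
      by (intro cg_mod) simp
    moreover have "cg (- (?x i * r)) 0"
      using coeffs_in_uminus[OF submodule_max coeffs_in_mult[OF submodule_max xA r(2)], of i]
      by (intro cg_if) simp
    ultimately have "cg (?x (Suc (k + i)) - ?x (k + i)) 0" by (rule cg_trans)
    then show ?thesis by (simp add: cg_def)
  qed
  have cg_x: "cg (?x (k + i)) (?x k)" for i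
  proof (induction i)
    case (Suc i)
    then show ?case using cg_trans[OF cg_step[of i]] by simp
  qed (simp add: cg_refl)
  have cg_x': "cg (?x i) (?x k)" if "k \<le> i" for i
    using cg_x[of "i - k"] that by simp

  \<comment> \<open>The matrix of the Frobenius on the quotient by \<open>g\<close> in the basis of
    the powers of \<open>z\<close> up to \<open>k\<close>. The vector \<open>v\<close> measures how
    far \<open>z ^ k\<close> is from being fixed by it.\<close>
  define c where "c i j = coeff (?x (p * i) mod g) j" for i j
  define v where "v j = coeff ((?x k ^ p - ?x k) mod g) j" for j
  have "artin_schreier_image (Suc k) c P v"
  proof (rule AS)
    show "c i j \<in> A" for i j
      using coeffs_in_mod[OF submodule_ring gA lc xA] by (simp add: c_def coeffs_in_def)
    have "cg (?x k ^ p) (?x k)"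
      unfolding monom_power using p_pos by (simp, intro cg_x') auto
    then show "v j \<in> P" for j by (simp add: v_def cg_def coeffs_in_def)
  qed
  then obtain y where y: "\<And>i. i < Suc k \<Longrightarrow> y i \<in> P"
      "\<And>j. j < Suc k \<Longrightarrow> v j = frob_map (Suc k) c y j - y j"
    unfolding artin_schreier_image_def by blast
  define J where "J = (\<Sum>i<Suc k. monom (y i) i)"
  have JP: "coeffs_in P J"
    unfolding J_def using y(1) by (intro coeffs_in_sum coeffs_in_monom submodule_max) auto
  have coeff_J: "coeff J j = (if j < Suc k then y j else 0)" for j
    unfolding J_def by (simp add: coeff_sum if_distrib cong: if_cong)
  have dJ: "degree J < Suc k"
    unfolding J_def by (intro degree_sum_less) (auto intro: le_less_trans[OF degree_monom_le])
  have Jp: "J ^ p = (\<Sum>i<Suc k. smult (y i ^ p) (?x (p * i)))"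
    unfolding J_def poly_frob_sum monom_power by (simp add: smult_monom)
  have J_mod: "coeff ((J ^ p - J) mod g) j = frob_map (Suc k) c y j - coeff J j" for j
    unfolding poly_mod_diff_left mod_poly_less[OF dJ[folded deg]] unfolding Jp poly_mod_sum_left
    by (simp add: mod_smult_left coeff_sum c_def frob_map_def mult.commute del: sum.lessThan_Suc)
  have "(J ^ p - J) mod g = (?x k ^ p - ?x k) mod g"
  proof (rule poly_eqI)
    fix j
    show "coeff ((J ^ p - J) mod g) j = coeff ((?x k ^ p - ?x k) mod g) j"
    proof (cases "j < Suc k")
      case True
      then show ?thesis using y(2)[of j] by (simp add: J_mod coeff_J v_def)
    next
      case False
      then have "degree (q mod g) < j" if "q mod g \<noteq> 0" for q
        using degree_mod_less'[OF g0 that] deg by simp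
      then show ?thesis by (metis coeff_eq_0 coeff_0)
    qed
  qed
  then have dvd1: "g dvd (?x k ^ p - ?x k) - (J ^ p - J)"
    by (metis mod_eq_dvd_iff)
  define Y where "Y = ?x k - J"
  have YA: "coeffs_in A Y"
    unfolding Y_def by (rule coeffs_in_diff[OF submodule_ring xA coeffs_in_max_imp[OF JP]])
  have dvd2: "g dvd Y ^ p - Y"
    using dvd1 by (simp add: Y_def poly_frob_diff algebra_simps)
  \<comment> \<open>\<open>Y\<close> is only fixed by the Frobenius; its power with exponent
    \<open>p - 1\<close> is idempotent modulo \<open>g\<close> and still congruent to
    \<open>z ^ k\<close>.\<close>
  define Z where "Z = Y ^ (p - 1)"
  have ZA: "coeffs_in A Z" unfolding Z_def by (rule coeffs_in_power[OF YA])
  obtain p' where p': "p = Suc (Suc p')" 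
    using less_imp_Suc_add[OF p_gt_1] by auto
  have "Z * Z - Z = Y ^ p' * (Y ^ p - Y)"
    unfolding Z_def p' by (simp add: algebra_simps power_add[symmetric])
  then have idem: "g dvd Z * Z - Z" using dvd2 by simp
  have cgY1: "cg Y (?x k)"
    using coeffs_in_uminus[OF submodule_max JP] by (intro cg_if) (simp add: Y_def)
  have cgY: "cg (Y ^ i) (?x k ^ i)" for i
  proof (induction i)
    case (Suc i)
    have "cg (Y * Y ^ i) (Y * ?x k ^ i)" by (rule cg_mult[OF Suc YA])
    moreover have "cg (?x k ^ i * Y) (?x k ^ i * ?x k)"
      by (rule cg_mult[OF cgY1 coeffs_in_power[OF xA]])
    ultimately show ?case using cg_trans[of "Y * Y ^ i" "Y * ?x k ^ i" "?x k * ?x k ^ i"]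
      by (simp add: mult.commute)
  qed (simp add: cg_refl)
  have cgZ: "cg Z (?x k)"
    using cg_trans[OF cgY[of "p - 1", unfolded monom_power power_one], of "?x k"]
      cg_x'[of "(p - 1) * k"] p'
    by (simp add: Z_def)
  \<comment> \<open>A linear form with value 1 on \<open>z ^ k\<close>, hence a unit on
    \<open>Z\<close>. If \<open>z\<close> acts on the module generated by \<open>Z\<close> as a
    scalar, the quotient of the values of \<open>tc\<close> must be that scalar.\<close>
  define tc where "tc q = coeff (q mod g) k" for q
  have tcx: "tc (?x k) = 1" by (simp add: tc_def mod_poly_less deg degree_monom_eq)
  have tccg: "tc q - tc s \<in> P" if "cg q s" for q s
    using that by (simp add: tc_def cg_def coeffs_in_def poly_mod_diff_left)
  have tcA: "tc q \<in> A" if "coeffs_in A q" for q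
    using coeffs_in_mod[OF submodule_ring gA lc that] by (simp add: tc_def coeffs_in_def)
  have tcZ: "tc Z \<in> A" "tc Z \<notin> P"
    using tcA[OF ZA] tccg[OF cgZ] tcx max_diff[of "tc Z" "tc Z - 1"] by auto
  then have inv: "inverse (tc Z) \<in> A" "tc Z \<noteq> 0" using nonmax_iff by auto
  define z where "z = tc (?x 1 * Z) / tc Z"
  have zA: "z \<in> A"
    unfolding z_def divide_inverse by (intro mult_mem tcA inv coeffs_in_mult submodule_ring xA ZA)
  have "cg (?x 1 * Z) (?x 1 * ?x k)" by (rule cg_mult[OF cgZ xA])
  moreover have "cg (?x 1 * ?x k) (?x k)" unfolding mult_monom by simp (rule cg_x', simp)
  ultimately have "tc (?x 1 * Z) - 1 \<in> P" using tccg[OF cg_trans] tcx by fastforce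
  then have "tc (?x 1 * Z) - 1 - (tc Z - 1) \<in> P"
    using tccg[OF cgZ] unfolding tcx by (rule max_diff)
  moreover have "z - 1 = (tc (?x 1 * Z) - 1 - (tc Z - 1)) * inverse (tc Z)"
    using inv by (simp add: z_def field_simps)
  ultimately have z1: "z - 1 \<in> P" using inv by (simp add: max_mult')

  define u where "u = ([:- z, 1:] * Z) mod g"
  have "[:- z, 1:] = ?x 1 - smult z 1" by (simp add: monom_altdef)
  then have u_eq: "u = (?x 1 * Z) mod g - smult z (Z mod g)"
    by (simp add: u_def left_diff_distrib poly_mod_diff_left mod_smult_left)
  have uk: "coeff u k = 0"
    using inv by (simp add: u_eq z_def tc_def)
  have du: "degree u < Suc k"
    using degree_mod_less[OF g0, of "[:- z, 1:] * Z"] deg unfolding u_def by auto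
  have Zu: "g dvd Z * u - u"
  proof -
    have "(Z * u) mod g = ([:- z, 1:] * (Z * Z)) mod g"
      unfolding u_def mod_mult_right_eq mult.left_commute[of Z "[:- z, 1:]"] ..
    moreover have "g dvd [:- z, 1:] * (Z * Z) - [:- z, 1:] * Z"
      using idem by (metis dvd_mult right_diff_distrib)
    then have "([:- z, 1:] * (Z * Z)) mod g = ([:- z, 1:] * Z) mod g"
      by (simp add: mod_eq_dvd_iff)
    ultimately have "(Z * u) mod g = u mod g" by (simp add: u_def)
    then show ?thesis by (simp add: mod_eq_dvd_iff)
  qed
  \<comment> \<open>Otherwise scale \<open>u\<close> to a primitive \<open>w\<close>, still with
    \<open>Z * w = w\<close> modulo \<open>g\<close>. In the reduction \<open>Z\<close> is
    \<open>z ^ k\<close>, which multiplication by \<open>z\<close> fixes, so \<open>w\<close> is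
    congruent to \<open>poly w 1\<close> times \<open>z ^ k\<close>. But \<open>w\<close> has
    coefficient 0 at \<open>k\<close> and coefficient 1 at \<open>i0\<close>.\<close>
  have "u = 0"
  proof (rule ccontr)
    assume "u \<noteq> 0"
    obtain i0 where i0: "i0 \<le> degree u" "\<And>j. j \<le> degree u \<Longrightarrow> \<exists>a\<in>A. coeff u j = a * coeff u i0"
      using coeff_divides_all[of "{..degree u}" "coeff u"] by auto
    have nz: "coeff u i0 \<noteq> 0"
      using i0(2)[of "degree u"] \<open>u \<noteq> 0\<close> by auto
    define w where "w = smult (inverse (coeff u i0)) u"
    have wA: "coeffs_in A w"
      unfolding coeffs_in_def
    proof
      fix j
      show "coeff w j \<in> A"
      proof (cases "j \<le> degree u")
        case True
        then obtain a where "a \<in> A" "coeff u j = a * coeff u i0" using i0(2) by blast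
        then show ?thesis using nz by (simp add: w_def mult.left_commute[of _ a])
      qed (simp add: w_def coeff_eq_0)
    qed
    have dw: "degree w < Suc k" unfolding w_def using du le_less_trans[OF degree_smult_le] by blast
    have "Z * w - w = smult (inverse (coeff u i0)) (Z * u - u)"
      by (simp add: w_def smult_diff_right)
    then have "g dvd Z * w - w" using Zu by (simp add: dvd_smult)
    then have "g dvd w - Z * w" by (simp add: dvd_diff_commute)
    then have "cg w (Z * w)" by (rule cg_mod)
    moreover have "cg (w * Z) (w * ?x k)" by (rule cg_mult[OF cgZ wA])
    moreover have "cg (w * ?x k) (smult (poly w 1) (?x k))"
    proof -
      have "w * ?x k = (\<Sum>i\<le>degree w. smult (coeff w i) (?x (k + i)))"
        by (subst poly_as_sum_of_monoms[of w, symmetric])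
          (simp add: sum_distrib_right mult_monom smult_monom add.commute)
      then have "w * ?x k - smult (poly w 1) (?x k) =
          (\<Sum>i\<le>degree w. smult (coeff w i) (?x (k + i) - ?x k))"
        by (simp add: poly_altdef smult_sum smult_diff_right sum_subtractf)
      then show ?thesis
        using cg_x wA unfolding cg_def coeffs_in_def[of A]
        by (simp add: poly_mod_sum_left mod_smult_left coeffs_in_sum coeffs_in_smult submodule_max)
    qed
    ultimately have "cg w (smult (poly w 1) (?x k))"
      using cg_trans by (metis mult.commute)
    moreover have "degree (w - smult (poly w 1) (?x k)) < degree g"
      unfolding deg using dw
      by (intro degree_diff_less le_less_trans[OF degree_smult_le]) (auto simp: degree_monom_eq)
    ultimately have wP: "coeff w i - poly w 1 * coeff (?x k) i \<in> P" for i
      by (simp add: cg_def mod_poly_less coeffs_in_def)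
    have "coeff w i0 = 1" "coeff w k = 0" using nz uk by (simp_all add: w_def)
    then show False using wP[of i0] by (cases "i0 = k") auto
  qed
  then have dvd3: "g dvd [:- z, 1:] * Z" by (simp add: u_def mod_eq_0_iff_dvd)
  have "poly g z = 0"
  proof (rule ccontr)
    assume nz: "poly g z \<noteq> 0"
    \<comment> \<open>Write \<open>g\<close> as \<open>z\<close>-linear factor times quotient plus
      the constant \<open>poly g z\<close>, and multiply by \<open>Z\<close>: a nonzero constant
      would make \<open>g\<close> divide \<open>Z\<close>, against
      \<open>tc Z \<noteq> 0\<close>.\<close>
    have "smult (poly g z) Z = g * Z - synthetic_div g z * ([:- z, 1:] * Z)"
      using arg_cong[OF synthetic_div_correct'[of z g], of "\<lambda>q. q * Z"] by (simp add: algebra_simps)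
    then have "g dvd smult (poly g z) Z" using dvd3 by (metis dvd_diff dvd_mult dvd_triv_left)
    then have "g dvd Z" using nz by (simp add: dvd_smult_iff)
    then have "tc Z = 0" by (simp add: tc_def mod_eq_0_iff_dvd)
    then show False using inv by simp
  qed
  then show ?thesis using z1 by blast
qed

text \<open>The root is sought as \<open>a + s / z\<close> with \<open>s\<close> the Newton
  correction and \<open>z\<close> close to 1. Inverting the unknown turns the constant term into the
  leading coefficient, so dividing by it gives a monic equation for \<open>z\<close>.\<close>

lemma henselian_if_artin_schreier_surjective:
  assumes AS: "\<And>n c v. (\<And>i j. i < n \<Longrightarrow> j < n \<Longrightarrow> c i j \<in> A) \<Longrightarrow> (\<And>i. i < n \<Longrightarrow> v i \<in> P) \<Longrightarrow>
      artin_schreier_image n c P v"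
  shows "henselian A"
  unfolding henselian_def
proof (intro allI impI)
  fix f :: "'a poly" and a
  assume "(\<forall>i. coeff f i \<in> A) \<and> a \<in> A \<and> poly f a \<in> P \<and> poly (pderiv f) a \<notin> P"
  then have f: "coeffs_in A f" "a \<in> A" "poly f a \<in> P" "poly (pderiv f) a \<notin> P"
    by (auto simp: coeffs_in_def)
  show "\<exists>b\<in>A. poly f b = 0 \<and> b - a \<in> P"
  proof (cases "poly f a = 0")
    case True
    then show ?thesis using f by (intro bexI[of _ a]) auto
  next
    case False
    define F where "F = pcompose f [:a, 1:]"
    have FA: "coeff F i \<in> A" for i
      using coeffs_in_pcompose[OF f(1), of "[:a, 1:]"] f(2) coeffs_in_one
      unfolding F_def coeffs_in_def by (simp add: coeff_pCons split: nat.splits)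
    define f0 f1 where "f0 = coeff F 0" and "f1 = coeff F 1"
    have f0: "f0 = poly f a"
      by (simp add: f0_def F_def poly_0_coeff_0[symmetric] poly_pcompose)
    have "f1 = poly (pderiv F) 0" by (simp add: f1_def poly_0_coeff_0 coeff_pderiv)
    also have "\<dots> = poly (pderiv f) a"
      by (simp add: F_def pderiv_pcompose poly_pcompose pderiv_pCons)
    finally have "f1 \<notin> P" using f(4) by simp
    moreover have "f1 \<in> A" using FA by (simp add: f1_def)
    ultimately have f1: "f1 \<in> A" "f1 \<notin> P" "f1 \<noteq> 0" "inverse f1 \<in> A"
      using nonmax_iff[of f1] by auto
    define s where "s = - (f0 / f1)"
    have s: "s \<in> P" using f(3) f1 unfolding s_def divide_inverse f0
      by (intro max_uminus max_mult')
    have nz: "f0 \<noteq> 0" using False f0 by simp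
    \<comment> \<open>The equation for \<open>z\<close> has degree \<open>Suc k\<close>, one more
      than \<open>F\<close>. This adds the root 0, which \<open>z - 1 \<in> P\<close>
      excludes.\<close>
    define k where "k = degree F"
    \<comment> \<open>\<open>F (s / z) = f0 z\<^sup>-\<^sup>k\<^sup>-\<^sup>1 \<Sum>\<^sub>i G\<^sub>i z\<^sup>k\<^sup>+\<^sup>1\<^sup>-\<^sup>i\<close> with \<open>G\<^sub>0 = 1\<close> and \<open>G\<^sub>1 = - 1\<close>\<close>
    define G where "G i = coeff F i * s ^ i / f0" for i
    have GP: "G i \<in> P" if i: "i \<ge> 2" for i
    proof -
      obtain i' where i': "i = Suc (Suc i')" using i by (metis add_2_eq_Suc le_Suc_ex)
      \<comment> \<open>One factor \<open>s\<close> cancels \<open>f0\<close> up to a unit; for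
        \<open>i \<ge> 2\<close> another one is left.\<close>
      have "G i = - (coeff F i * inverse f1 * s ^ i') * s"
        using nz f1 by (simp add: G_def i' s_def field_simps)
      also have "\<dots> \<in> P"
        by (rule max_mult[OF _ s]) (intro uminus_mem mult_mem power_mem FA f1 max_imp_mem[OF s])
      finally show ?thesis .
    qed
    have G01: "G 0 = 1" "G (Suc 0) = - 1"
      using nz f1(3) by (simp_all add: G_def f0_def f1_def s_def)
    define r where "r = (\<Sum>i\<in>{2..Suc k}. monom (G i) (Suc k - i))"
    have "\<exists>z. poly (monom 1 (Suc k) - monom 1 k + r) z = 0 \<and> z - 1 \<in> P"
    proof (rule root_if_artin_schreier_surjective)
      show "degree r < Suc k"
        unfolding r_def by (intro degree_sum_less) (auto intro: le_less_trans[OF degree_monom_le])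
      show "coeffs_in P r"
        unfolding r_def by (intro coeffs_in_sum coeffs_in_monom submodule_max GP) auto
    qed (rule AS)
    then obtain z where root: "z ^ Suc k - z ^ k + (\<Sum>i\<in>{2..Suc k}. G i * z ^ (Suc k - i)) = 0"
      and z1: "z - 1 \<in> P"
      by (auto simp: poly_monom r_def poly_sum simp del: sum.cl_ivl_Suc power_Suc)
    have "z = (z - 1) + 1" by simp
    then have zA: "z \<in> A" using max_imp_mem[OF z1] add_mem[of "z - 1" 1] by simp
    have "z \<notin> P" using max_diff[OF _ z1, of z] by auto
    then have z: "z \<noteq> 0" "inverse z \<in> A" using zA nonmax_iff by auto
    have sz: "s * inverse z \<in> P" using s z by (intro max_mult')
    have "poly f (a + s * inverse z) = poly F (s * inverse z)"
      by (simp add: F_def poly_pcompose)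
    also have "\<dots> = (\<Sum>i\<le>Suc k. coeff F i * (s * inverse z) ^ i)"
      unfolding poly_altdef k_def by (simp add: coeff_eq_0)
    also have "\<dots> * z ^ Suc k = f0 * (\<Sum>i\<le>Suc k. G i * z ^ (Suc k - i))"
      unfolding sum_distrib_left sum_distrib_right
    proof (intro sum.cong refl)
      fix i assume "i \<in> {..Suc k}"
      then have "z ^ Suc k = z ^ i * z ^ (Suc k - i)" by (simp flip: power_add)
      then show "coeff F i * (s * inverse z) ^ i * z ^ Suc k = f0 * (G i * z ^ (Suc k - i))"
        using nz z by (simp add: G_def power_mult_distrib power_inverse)
    qed
    also have "{..Suc k} = insert 0 (insert 1 {2..Suc k})" by auto
    also have "(\<Sum>i\<in>\<dots>. G i * z ^ (Suc k - i)) = 0"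
      using root G01 by (simp add: algebra_simps del: sum.cl_ivl_Suc power_Suc)
    finally have "poly f (a + s * inverse z) = 0" using z by simp
    then show ?thesis
      using sz f(2) by (intro bexI[of _ "a + s * inverse z"]) (auto intro: add_mem max_imp_mem)
  qed
qed

end

theorem theorem2p4:
  fixes \<O> :: "'a::field set"
  assumes "valuation_ring \<O>"
    and "CHAR('a) > 0"
    and "NIP_theory TYPE('a) (complete_theory (valued_field_struct \<O>))"
  shows "henselian \<O>"
proof -
  interpret char_p_valued_field \<O> "CHAR('a)"
    using assms by unfold_locales auto
  show ?thesis
  proof (cases "P = {0}")
    case True
    show ?thesis
      unfolding henselian_def
    proof (intro allI impI)
      fix f :: "'a poly" and a
      assume "(\<forall>i. coeff f i \<in> \<O>) \<and> a \<in> \<O> \<and> poly f a \<in> P \<and> poly (pderiv f) a \<notin> P"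
      then show "\<exists>b\<in>\<O>. poly f b = 0 \<and> b - a \<in> P"
        using True by (intro bexI[of _ a]) auto
    qed
  next
    case False
    then have inf: residue_field_infinite
      using residue_field_infinite_if_artin_schreier_closed
        artin_schreier_closed[OF assms(3) infinite_if_nontrivial] by blast
    show ?thesis
    proof (rule henselian_if_artin_schreier_surjective)
      fix n :: nat and c v
      assume "\<And>i j. i < n \<Longrightarrow> j < n \<Longrightarrow> c i j \<in> \<O>" "\<And>i. i < n \<Longrightarrow> v i \<in> P"
      then show "artin_schreier_image n c P v"
        using p_pos by (intro NIP_artin_schreier_surjective[OF assms(3) definable_set_maximal_ideal
              submodule_max max_power inf])
    qed
  qed
qed

end
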